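(* Let $\boldsymbol{g}=(g_1,\ldots,g_n)'$ be a measurable rate vector of length $n$ and let $S$ be the set of all $x\in(0,\infty)$ for which there exists a matrix $\boldsymbol{A}(x)\in\mathbb{R}^{n\times n}$ such that $$\boldsymbol{g}(xt)=\boldsymbol{A}(x)\,\boldsymbol{g}(t)+o(g_n(t)),\qquad t\to\infty.$$ If $S$ contains a set of positive Lebesgue measure and if both $S\cap(0,1)$ and $S\cap(1,\infty)$ are non-empty, then $\boldsymbol{g}\in R_{\boldsymbol{B}}$ for some index matrix $\boldsymbol{B}\in\mathbb{R}^{n\times n}$.
   Context: Limit relations are as $t\to\infty$; measurability and measure are Lebesgue. A real function is defined in a neighbourhood of infinity if its domain contains some $[t_0,\infty)$; it is eventually of constant sign if it is either strictly positive for all large $t$ or strictly negative for all large $t$. A rate vector of length $n$ is a column vector $\boldsymbol{g}=(g_1,\ldots,g_n)'$ of real-valued functions defined in a neighbourhood of infinity, each eventually of constant sign, with $g_{i+1}(t)=o(g_i(t))$ for every $i\in\{1,\ldots,n-1\}$; $o(g_n(t))$ means $o(|g_n(t)|)$, and for vector-valued quantities it is understood componentwise. For a square matrix $\boldsymbol{B}$ and $x>0$, $x^{\boldsymbol{B}}=\exp\{(\log x)\boldsymbol{B}\}$. An index matrix is an upper triangular $\boldsymbol{B}\in\mathbb{R}^{n\times n}$ whose diagonal elements are non-increasing ($B_{11}\geq\cdots\geq B_{nn}$) and all of whose eigenvalues, except possibly the smallest one, have geometric multiplicity one. A rate vector $\boldsymbol{g}$ is regularly varying with index matrix $\boldsymbol{B}$,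 written $\boldsymbol{g}\in R_{\boldsymbol{B}}$, if $\boldsymbol{g}$ is measurable and $\boldsymbol{g}(xt)=x^{\boldsymbol{B}}\boldsymbol{g}(t)+o(g_n(t))$ for every $x\in(0,\infty)$. *)

theory Defs
  imports
    "HOL-Library.Landau_Symbols"
    "HOL-Analysis.Equivalence_Lebesgue_Henstock_Integration"
    "Jordan_Normal_Form.Matrix_Kernel"
    "Jordan_Normal_Form.Char_Poly"
begin

unbundle no vec_syntax

text \<open>
  A vector of \<open>n\<close> real functions with individual domains is a pair of families \<open>D\<close>, \<open>g\<close>: the
  \<open>i\<close>-th component, \<open>i < n\<close> (indices start at \<open>0\<close>), is the restriction of \<open>g i\<close> to \<open>D i\<close>.
  Values of \<open>g i\<close> outside \<open>D i\<close> are arbitrary; the limit relations below do not depend on them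
  when \<open>D i\<close> is a neighbourhood of infinity.
\<close>

definition nbhd_of_infinity :: "real set \<Rightarrow> bool" where
  "nbhd_of_infinity D \<longleftrightarrow> (\<exists>t0. {t0..} \<subseteq> D)"

definition eventually_constant_sign :: "(real \<Rightarrow> real) \<Rightarrow> bool" where
  "eventually_constant_sign f \<longleftrightarrow>
     (\<forall>\<^sub>F t in at_top. f t > 0) \<or> (\<forall>\<^sub>F t in at_top. f t < 0)"

definition rate_vector :: "nat \<Rightarrow> (nat \<Rightarrow> real set) \<Rightarrow> (nat \<Rightarrow> real \<Rightarrow> real) \<Rightarrow> bool" where
  "rate_vector n D g \<longleftrightarrow> n \<ge> 1
     \<and> (\<forall>i<n. nbhd_of_infinity (D i) \<and> eventually_constant_sign (g i))
     \<and> (\<forall>i. Suc i < n \<longrightarrow> g (Suc i) \<in> o[at_top](g i))"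

definition measurable_components ::
    "nat \<Rightarrow> (nat \<Rightarrow> real set) \<Rightarrow> (nat \<Rightarrow> real \<Rightarrow> real) \<Rightarrow> bool" where
  "measurable_components n D g \<longleftrightarrow>
     (\<forall>i<n. D i \<in> sets lebesgue \<and> g i \<in> borel_measurable (lebesgue_on (D i)))"

definition eval_vec :: "nat \<Rightarrow> (nat \<Rightarrow> real \<Rightarrow> real) \<Rightarrow> real \<Rightarrow> real vec" where
  "eval_vec n g t = Matrix.vec n (\<lambda>i. g i t)"

text \<open>\<open>g(x t) = A g(t) + o(g\<^sub>n(t))\<close>; the last component has index \<open>n - 1\<close>.\<close>

definition scales_by ::
    "nat \<Rightarrow> (nat \<Rightarrow> real \<Rightarrow> real) \<Rightarrow> real \<Rightarrow> real mat \<Rightarrow> bool" where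
  "scales_by n g x A \<longleftrightarrow>
     (\<forall>i<n. (\<lambda>t. (eval_vec n g (x * t) - A *\<^sub>v eval_vec n g t) $ i) \<in> o[at_top](\<lambda>t. \<bar>g (n - 1) t\<bar>))"

definition scaling_set :: "nat \<Rightarrow> (nat \<Rightarrow> real \<Rightarrow> real) \<Rightarrow> real set" where
  "scaling_set n g = {x \<in> {0<..}. \<exists>A \<in> carrier_mat n n. scales_by n g x A}"

text \<open>The exponential series of a square matrix, entrywise.\<close>

definition mat_exp :: "real mat \<Rightarrow> real mat" where
  "mat_exp A = Matrix.mat (dim_row A) (dim_col A) (\<lambda>(i, j). \<Sum>k. (A ^\<^sub>m k) $$ (i, j) / fact k)"

definition mat_powr :: "real \<Rightarrow> real mat \<Rightarrow> real mat" where
  "mat_powr x B = mat_exp (ln x \<cdot>\<^sub>m B)"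

definition geometric_multiplicity :: "real mat \<Rightarrow> real \<Rightarrow> nat" where
  "geometric_multiplicity B b = kernel_dim (char_matrix B b)"

text \<open>
  All eigenvalues of a real upper triangular matrix are real, so it suffices to consider real
  ones. An eigenvalue is not the smallest one iff some eigenvalue lies strictly below it.
\<close>

definition index_matrix :: "nat \<Rightarrow> real mat \<Rightarrow> bool" where
  "index_matrix n B \<longleftrightarrow> B \<in> carrier_mat n n \<and> upper_triangular B
     \<and> (\<forall>i j. i \<le> j \<and> j < n \<longrightarrow> B $$ (i, i) \<ge> B $$ (j, j))
     \<and> (\<forall>b. eigenvalue B b \<and> (\<exists>c. eigenvalue B c \<and> c < b) \<longrightarrow> geometric_multiplicity B b = 1)"

definition regularly_varying ::
    "nat \<Rightarrow> (nat \<Rightarrow> real set) \<Rightarrow> (nat \<Rightarrow> real \<Rightarrow> real) \<Rightarrow> real mat \<Rightarrow> bool" where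
  "regularly_varying n D g B \<longleftrightarrow> rate_vector n D g \<and> index_matrix n B
     \<and> measurable_components n D g \<and> (\<forall>x>0. scales_by n g x (mat_powr x B))"

end

theory Submission
  imports Defs
begin

text \<open>
  The matrices \<open>A(x)\<close> are unique, because the components of a rate vector are linearly independent
  modulo \<open>o(g\<^sub>n)\<close>, and upper triangular, because \<open>g\<^sub>i\<^sub>+\<^sub>1 = o(g\<^sub>i)\<close>. Hence the scaling set is a
  multiplicative semigroup and \<open>A\<close> is a homomorphism on it. By a Steinhaus argument the semigroup
  contains an interval, and then it is all of \<open>(0, \<infinity>)\<close>. The entries of \<open>A\<close> are limits of measurable
  functions, so \<open>A\<close> is a measurable matrix homomorphism; it is locally bounded, hence smooth after
  averaging, and Taylor expansion gives \<open>A(x) = x\<^sup>B\<close>. The diagonal of \<open>B\<close> is non-increasing because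
  \<open>g\<^sub>i\<^sub>+\<^sub>1 / g\<^sub>i\<close> tends to zero. A left eigenvector \<open>v\<close> of \<open>B\<close> with eigenvalue \<open>b > B\<^sub>n\<^sub>n\<close> satisfies
  \<open>v g(t) = c t\<^sup>b + o(g\<^sub>n(t))\<close>, so two of them are linearly dependent.
\<close>

text \<open>For instance g(t) = exp(-t) has scaling set [1, oo) with A(x) = 0 for x > 1; this is why
  scaling points on both sides of 1 are required. Inverses are used only once the homomorphism lives
  on all of (0, oo).

  Averaging is applied twice: first to pass from measurable and bounded to continuous, then from
  continuous to differentiable. What makes it reversible is that the averaged matrix is triangular
  with positive diagonal.

  Left eigenvectors appear because a row vector turns the system into one scalar function. Geometric
  multiplicity concerns the right kernel, and the two sides are matched through the Gauss-Jordan
  form. The condition b > B_nn makes |g_n(t)| / t^b decay geometrically along repeated doubling of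
  t. This decay is what controls the accumulated errors, and it fails at b = B_nn, which is why the
  smallest eigenvalue is exempt.\<close>

section \<open>Sumsets of sets of positive measure\<close>

text \<open>An elementary substitute for the density theorem. If \<open>K\<close> filled at most 3/4
  of every interval, summing over the cells of a fine grid that meet \<open>K\<close> would give |K|
  <= 3/4 |U| for an open \<open>U\<close> around \<open>K\<close>. The tolerance |K|/3 gives |U| <
  4/3 |K|, a contradiction.\<close>

lemma compact_dense_in_interval:
  fixes K :: "real set"
  assumes "compact K" "measure lebesgue K > 0"
  shows "\<exists>c \<delta>. \<delta> > 0 \<and> measure lebesgue (K \<inter> {c..c+\<delta>}) > 3/4 * \<delta>"
proof (rule ccontr)
  assume neg: "\<not> ?thesis"
  let ?m = "measure lebesgue K"
  have Km: "K \<in> lmeasurable" using assms(1) by (rule lmeasurable_compact)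
  then obtain U where U: "open U" "K \<subseteq> U" "U - K \<in> lmeasurable"
      "emeasure lebesgue (U - K) < ennreal (?m / 3)"
    using sets_lebesgue_outer_open[of K "?m/3"] assms(2) by auto
  have UK: "U = K \<union> (U - K)" using U(2) by blast
  have Um: "U \<in> lmeasurable" using fmeasurable.Un[OF Km U(3)] UK by simp
  have "measure lebesgue (U - K) < ?m / 3"
    using U(3,4) assms(2) emeasure_eq_measure2[OF U(3)] by (simp add: ennreal_less_iff)
  moreover have "measure lebesgue U = ?m + measure lebesgue (U - K)"
    using measure_Un3[OF Km U(3)] UK by simp
  ultimately have U4: "measure lebesgue U < 4/3 * ?m" by simp
  obtain d where d: "d > 0" "(\<Union>x\<in>K. ball x d) \<subseteq> U"
    using compact_subset_open_imp_ball_epsilon_subset[OF assms(1) U(1,2)] by blast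
  \<comment> \<open>The cells are half-open, hence disjoint, and have length \<open>d\<close>, so a
    cell meeting \<open>K\<close> stays inside the \<open>d\<close>-neighbourhood of
    \<open>K\<close> and thus inside \<open>U\<close>.\<close>
  define I where "I j = {real_of_int j * d ..< real_of_int j * d + d}" for j
  define J where "J = (\<lambda>x. \<lfloor>x / d\<rfloor>) ` K"
  have memI: "x \<in> I j \<longleftrightarrow> \<lfloor>x / d\<rfloor> = j" for x j
    using d(1) by (simp add: I_def floor_eq_iff field_simps)
  have "finite J"
  proof -
    obtain R where R: "\<And>x. x \<in> K \<Longrightarrow> \<bar>x\<bar> \<le> R"
      using compact_imp_bounded[OF assms(1)] by (auto simp: bounded_iff)
    have "J \<subseteq> {\<lfloor>-R/d\<rfloor>..\<lfloor>R/d\<rfloor>}"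
    proof
      fix j assume "j \<in> J"
      then obtain x where x: "x \<in> K" "j = \<lfloor>x/d\<rfloor>" by (auto simp: J_def)
      have "-R/d \<le> x/d" "x/d \<le> R/d"
        using R[OF x(1)] d(1) by (auto simp: abs_le_iff divide_right_mono divide_le_cancel field_simps)
      then show "j \<in> {\<lfloor>-R/d\<rfloor>..\<lfloor>R/d\<rfloor>}"
        unfolding x(2) by (auto intro: floor_mono)
    qed
    then show ?thesis using finite_subset by blast
  qed
  have Im[simp]: "I j \<in> lmeasurable" "measure lebesgue (I j) = d" for j
    using d(1) by (auto simp: I_def intro: bounded_set_imp_lmeasurable)
  have IU: "I j \<subseteq> U" if jJ: "j \<in> J" for j
  proof
    fix y assume y: "y \<in> I j"
    obtain x where x: "x \<in> K" "x \<in> I j" using jJ memI by (auto simp: J_def)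
    then have "y \<in> ball x d" using y d(1) by (auto simp: I_def dist_real_def)
    then show "y \<in> U" using d(2) x by blast
  qed
  have disj: "disjoint_family_on I J"
    by (auto simp: disjoint_family_on_def) (metis memI)
  have "?m = measure lebesgue (\<Union>j\<in>J. K \<inter> I j)"
    by (rule arg_cong[where f="measure lebesgue"]) (auto simp: J_def memI)
  also have "\<dots> \<le> (\<Sum>j\<in>J. measure lebesgue (K \<inter> I j))"
    using Km Im \<open>finite J\<close> by (intro measure_UNION_le fmeasurableD fmeasurable.Int) auto
  also have "\<dots> \<le> (\<Sum>j\<in>J. 3/4 * d)"
  proof (rule sum_mono)
    fix j assume "j \<in> J"
    have "measure lebesgue (K \<inter> I j) \<le> measure lebesgue (K \<inter> {real_of_int j * d..real_of_int j * d + d})"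
      using Km Im by (intro measure_mono_fmeasurable fmeasurable.Int fmeasurableD) (auto simp: I_def)
    also have "\<dots> \<le> 3/4 * d" using neg d(1) by (meson not_less)
    finally show "measure lebesgue (K \<inter> I j) \<le> 3/4 * d" .
  qed
  also have "\<dots> = 3/4 * (\<Sum>j\<in>J. measure lebesgue (I j))" by simp
  also have "(\<Sum>j\<in>J. measure lebesgue (I j)) = measure lebesgue (\<Union>j\<in>J. I j)"
    using \<open>finite J\<close> disj by (intro measure_finite_Union[symmetric]) (use fmeasurableD2[OF Im(1)] in \<open>auto intro: fmeasurableD\<close>)
  also have "\<dots> \<le> measure lebesgue U"
    using Um IU \<open>finite J\<close> by (intro measure_mono_fmeasurable) (auto intro!: sets.finite_UN fmeasurableD)
  finally show False using U4 by simp
qed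

text \<open>Reflection argument: z is a sum of two points of G iff G meets z - G. Both sets have
  measure above 3/4 \<delta>, while together they lie in an interval of length \<delta> + |z - 2c -
  \<delta>|, which is less than 3/2 \<delta> for the z considered. So they cannot be
  disjoint.\<close>

lemma compact_sumset_interval:
  fixes K :: "real set"
  assumes "compact K" "measure lebesgue K > 0"
  shows "\<exists>u v. u < v \<and> (\<forall>z\<in>{u<..<v}. \<exists>a\<in>K. \<exists>b\<in>K. z = a + b)"
proof -
  obtain c \<delta> where cd: "\<delta> > 0" "measure lebesgue (K \<inter> {c..c+\<delta>}) > 3/4 * \<delta>"
    using compact_dense_in_interval[OF assms] by blast
  define G where "G = K \<inter> {c..c+\<delta>}"
  have Gc: "compact G" unfolding G_def by (intro compact_Int assms(1)) auto
  then have Gm: "G \<in> lmeasurable" by (rule lmeasurable_compact)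
  have "\<exists>a\<in>K. \<exists>b\<in>K. z = a + b" if z: "z \<in> {2*c+\<delta>/2<..<2*c+3/2*\<delta>}" for z
  proof (rule ccontr)
    assume neg: "\<not> ?thesis"
    define G' where "G' = (\<lambda>x. z + (-1) *\<^sub>R x) ` G"
    have disj: "disjnt G G'"
      using neg by (force simp: disjnt_def G'_def G_def)
    have "emeasure lebesgue G' = emeasure lebesgue G"
      using emeasure_lebesgue_affine[of "-1" z G] by (simp add: G'_def)
    moreover have "G' \<in> lmeasurable"
      unfolding G'_def by (intro lmeasurable_compact compact_continuous_image continuous_intros Gc)
    ultimately have G'm: "G' \<in> lmeasurable" "measure lebesgue G' = measure lebesgue G"
      by (auto simp: measure_def)
    define l where "l = min c (z - c - \<delta>)"
    define r where "r = max (c + \<delta>) (z - c)"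
    have "2 * measure lebesgue G = measure lebesgue (G \<union> G')"
      using measure_Un3[OF Gm G'm(1)] G'm(2) disj by (simp add: disjnt_def)
    also have "\<dots> \<le> measure lebesgue {l..r}"
      using Gm G'm by (intro measure_mono_fmeasurable) (auto simp: l_def r_def G_def G'_def)
    also have "\<dots> \<le> 3/2 * \<delta>"
      using z cd(1) by (auto simp: l_def r_def min_def max_def)
    finally show False using cd(2) by (simp add: G_def)
  qed
  then show ?thesis using cd(1)
    by (intro exI[of _ "2*c+\<delta>/2"] exI[of _ "2*c+3/2*\<delta>"]) auto
qed

text \<open>Inner approximation and truncation replace \<open>E\<close> by a compact
  \<open>K\<close> of positive measure. Its logarithm \<open>L\<close> is again not null, since the
  differentiable map \<open>exp\<close> sends null sets to null sets, and the additive statement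
  applies to \<open>L\<close>.\<close>

lemma exp_interval_mult_closure:
  fixes E :: "real set"
  assumes "E \<in> sets lebesgue" "emeasure lebesgue E > 0" "E \<subseteq> {0<..}"
  shows "\<exists>u v. u < v \<and> (\<forall>z\<in>{u<..<v}. \<exists>a\<in>E. \<exists>b\<in>E. exp z = a * b)"
proof -
  obtain e where e: "e > 0" "ennreal e < emeasure lebesgue E"
  proof -
    obtain y where y: "0 < y" "y < emeasure lebesgue E" using dense[OF assms(2)] by blast
    then show ?thesis using that by (cases y) (auto simp: top_unique)
  qed
  obtain T where T: "closed T" "T \<subseteq> E" "E - T \<in> lmeasurable" "emeasure lebesgue (E - T) < ennreal e"
    using sets_lebesgue_inner_closed[OF assms(1) e(1)] by blast
  have "\<not> negligible T"
  proof
    assume "negligible T"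
    then have "T \<in> null_sets lebesgue" by (simp add: negligible_iff_null_sets)
    moreover have "E = (E - T) \<union> T" using T(2) by blast
    ultimately have "emeasure lebesgue E = emeasure lebesgue (E - T)"
      by (metis T(3) emeasure_Un_null_set fmeasurableD)
    then show False using T(4) e(2) by simp
  qed
  moreover have "T = (\<Union>N::nat. T \<inter> {0..real N})"
  proof -
    have "\<exists>N::nat. x \<in> T \<inter> {0..real N}" if "x \<in> T" for x
      using that T(2) assms(3) real_arch_simple[of x] by (auto simp: less_imp_le)
    then show ?thesis by blast
  qed
  moreover have "negligible (\<Union>N::nat. T \<inter> {0..real N})" if "\<And>N::nat. negligible (T \<inter> {0..real N})"
    using that by (intro negligible_countable_Union) auto
  ultimately have "\<not> (\<forall>N::nat. negligible (T \<inter> {0..real N}))" by auto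
  then obtain N :: nat where N: "\<not> negligible (T \<inter> {0..real N})" by blast
  define K where "K = T \<inter> {0..real N}"
  have K: "compact K" "K \<subseteq> {0<..}" "K \<subseteq> E"
    using T assms(3) by (auto simp: K_def intro: closed_Int_compact)
  define L where "L = ln ` K"
  have Lc: "compact L"
    unfolding L_def using K by (intro compact_continuous_image continuous_intros) auto
  have KL: "K = exp ` L" using K(2) by (force simp: L_def image_image)
  have "measure lebesgue L > 0"
  proof (rule ccontr)
    assume "\<not> ?thesis"
    then have "measure lebesgue L = 0"
      using measure_nonneg[of lebesgue L] by linarith
    then have "negligible L"
      using lmeasurable_compact[OF Lc] by (simp add: negligible_iff_measure)
    then have "negligible (exp ` L)"
      by (rule negligible_differentiable_image_negligible[rotated])
         (auto simp: differentiable_on_def real_differentiable_def intro!: exI has_field_derivative_at_within[OF DERIV_exp])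
    then show False using N KL by (simp add: K_def)
  qed
  then obtain u v where uv: "u < v" "\<forall>z\<in>{u<..<v}. \<exists>a\<in>L. \<exists>b\<in>L. z = a + b"
    using compact_sumset_interval[OF Lc] by blast
  have "\<forall>z\<in>{u<..<v}. \<exists>a\<in>E. \<exists>b\<in>E. exp z = a * b"
  proof
    fix z assume "z \<in> {u<..<v}"
    then obtain a b where "a \<in> L" "b \<in> L" "z = a + b" using uv(2) by blast
    then show "\<exists>a\<in>E. \<exists>b\<in>E. exp z = a * b"
      using KL K(3) by (intro bexI[of _ "exp a"] bexI[of _ "exp b"]) (auto simp: exp_add)
  qed
  then show ?thesis using uv(1) by blast
qed

text \<open>The k-fold sums of the given interval are intervals of length k (v - u). Once such an
  interval is longer than both \<open>q\<close> and \<open>-p\<close>, shifting \<open>r\<close> by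
  multiples of \<open>q\<close> or \<open>p\<close> cannot jump over it, and adding the shifts back
  recovers \<open>r\<close> without any subtraction inside \<open>T\<close>.\<close>

lemma additive_semigroup_UNIV:
  fixes T :: "real set"
  assumes add: "\<And>x y. x \<in> T \<Longrightarrow> y \<in> T \<Longrightarrow> x + y \<in> T"
    and uv: "u < v" "{u<..<v} \<subseteq> T" and p: "p \<in> T" "p < 0" and q: "q \<in> T" "q > 0"
  shows "r \<in> T"
proof -
  have mult: "{real (Suc k) * u <..< real (Suc k) * v} \<subseteq> T" for k
  proof (induction k)
    case (Suc k)
    show ?case
    proof
      fix x assume x: "x \<in> {real (Suc (Suc k)) * u <..< real (Suc (Suc k)) * v}"
      define y where "y = x / real (Suc (Suc k))"
      then have "x = real (Suc (Suc k)) * y" by (simp add: y_def del: of_nat_Suc)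
      moreover have "u < y" "y < v"
        using x by (simp_all add: y_def pos_less_divide_eq pos_divide_less_eq mult.commute del: of_nat_Suc)
      moreover have "real (Suc (Suc k)) * y = real (Suc k) * y + y"
        by (simp add: algebra_simps)
      ultimately have y: "x = real (Suc k) * y + y" "u < y" "y < v"
        by simp_all
      have "real (Suc k) * y \<in> T" using y by (intro subsetD[OF Suc.IH]) (simp del: of_nat_Suc)
      moreover have "y \<in> T" using y uv(2) by auto
      ultimately show "x \<in> T" unfolding y(1) by (rule add)
    qed
  qed (use uv in auto)
  have addmul: "x + real l * w \<in> T" if "x \<in> T" "w \<in> T" for x w l
  proof (induction l)
    case (Suc l)
    then show ?case using add[OF Suc.IH that(2)] by (simp add: algebra_simps)
  qed (use that in simp)
  obtain k :: nat where k: "real k * (v - u) > max q (-p)"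
    using reals_Archimedean3[of "v - u"] uv(1) by (auto simp del: max_less_iff_conj)
  define a where "a = real (Suc k) * u"
  define b where "b = real (Suc k) * v"
  have "b - a = real k * (v - u) + (v - u)"
    by (simp add: a_def b_def algebra_simps)
  then have ab: "b - a > q" "b - a > -p" "{a<..<b} \<subseteq> T"
    using k mult[of k] uv(1) unfolding a_def b_def by (simp_all del: of_nat_Suc)
  show ?thesis
  proof (cases "r > a")
    case True
    have ex: "\<exists>l::nat. r - real l * q < b"
    proof -
      obtain l :: nat where "real l * q > r - b" using reals_Archimedean3[OF q(2)] by blast
      then show ?thesis by (intro exI[of _ l]) simp
    qed
    \<comment> \<open>First shift that falls below \<open>b\<close>. The preceding one was still at
      least \<open>b\<close>, and the step \<open>q\<close> is shorter than b - a, so this one is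
      still above \<open>a\<close>.\<close>
    define l where "l = (LEAST l::nat. r - real l * q < b)"
    have l: "r - real l * q < b" unfolding l_def using LeastI_ex[OF ex] .
    have "r - real l * q > a"
    proof (cases l)
      case 0 then show ?thesis using True by simp
    next
      case (Suc m)
      then have "\<not> r - real m * q < b" using not_less_Least[of m "\<lambda>l. r - real l * q < b"] by (simp add: l_def)
      then show ?thesis using ab Suc by (simp add: algebra_simps)
    qed
    then have "r - real l * q \<in> T" using l ab(3) by auto
    then show ?thesis using addmul[OF _ q(1), of "r - real l * q" l] by simp
  next
    case False
    have ex: "\<exists>l::nat. r - real l * p > a"
    proof -
      obtain l :: nat where "real l * (-p) > a - r" using reals_Archimedean3[of "-p"] p(2) by auto
      then show ?thesis by (intro exI[of _ l]) simp
    qed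
    define l where "l = (LEAST l::nat. r - real l * p > a)"
    have l: "r - real l * p > a" unfolding l_def using LeastI_ex[OF ex] .
    have "r - real l * p < b"
    proof (cases l)
      case 0 then show ?thesis using False ab q by simp
    next
      case (Suc m)
      then have "\<not> r - real m * p > a" using not_less_Least[of m "\<lambda>l. r - real l * p > a"] by (simp add: l_def)
      then show ?thesis using ab Suc by (simp add: algebra_simps)
    qed
    then have "r - real l * p \<in> T" using l ab(3) by auto
    then show ?thesis using addmul[OF _ p(1), of "r - real l * p" l] by simp
  qed
qed

lemma mult_semigroup_positive_reals:
  fixes S :: "real set"
  assumes mult: "\<And>x y. x \<in> S \<Longrightarrow> y \<in> S \<Longrightarrow> x * y \<in> S" and pos: "S \<subseteq> {0<..}"
    and E: "E \<subseteq> S" "E \<in> sets lebesgue" "emeasure lebesgue E > 0"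
    and lt: "S \<inter> {0<..<1} \<noteq> {}" and gt: "S \<inter> {1<..} \<noteq> {}"
  shows "S = {0<..}"
proof -
  obtain u v where uv: "u < v" "\<forall>z\<in>{u<..<v}. \<exists>a\<in>E. \<exists>b\<in>E. exp z = a * b"
    using exp_interval_mult_closure[OF E(2,3)] E(1) pos by blast
  obtain p q where p: "p \<in> S" "0 < p" "p < 1" and q: "q \<in> S" "q > 1" using lt gt by auto
  have "x \<in> S" if "x > 0" for x
  proof -
    have "ln x \<in> {s. exp s \<in> S}"
    proof (rule additive_semigroup_UNIV[OF _ uv(1)])
      show "{u<..<v} \<subseteq> {s. exp s \<in> S}"
      proof
        fix z assume "z \<in> {u<..<v}"
        then obtain a b where "a \<in> E" "b \<in> E" "exp z = a * b" using uv(2) by blast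
        then show "z \<in> {s. exp s \<in> S}" using E(1) mult[of a b] by auto
      qed
      show "ln p \<in> {s. exp s \<in> S}" "ln p < 0" "ln q \<in> {s. exp s \<in> S}" "ln q > 0"
        using p q by auto
    qed (auto simp: exp_add mult)
    then show ?thesis using that by simp
  qed
  then show ?thesis using pos by auto
qed

section \<open>Linear relations modulo the last rate\<close>

locale rates =
  fixes n :: nat and g :: "nat \<Rightarrow> real \<Rightarrow> real"
  assumes n_pos: "n \<ge> 1"
    and ev_nonzero: "i < n \<Longrightarrow> \<forall>\<^sub>F t in at_top. g i t \<noteq> 0"
    and step: "Suc i < n \<Longrightarrow> g (Suc i) \<in> o[at_top](g i)"
begin

lemma smallo_less: "i < j \<Longrightarrow> j < n \<Longrightarrow> g j \<in> o[at_top](g i)"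
proof (induction j)
  case (Suc j)
  have "g (Suc j) \<in> o[at_top](g j)" using step Suc.prems by simp
  then show ?case
    using Suc by (cases "i = j") (auto intro: landau_o.small_trans)
qed simp

lemma bigo_le: "i \<le> j \<Longrightarrow> j < n \<Longrightarrow> g j \<in> O[at_top](g i)"
  using smallo_less[of i j] by (cases "i = j") (auto intro: landau_o.small_imp_big)

lemma smallo_last: "i < n \<Longrightarrow> f \<in> o[at_top](g (n - 1)) \<Longrightarrow> f \<in> o[at_top](g i)"
  using bigo_le[of i "n - 1"] by (auto intro: landau_o.small_big_trans)

lemma not_smallo_self: "i < n \<Longrightarrow> (\<lambda>t. c * g i t) \<in> o[at_top](g i) \<Longrightarrow> c = 0"
proof (rule ccontr)
  assume i: "i < n" and c: "(\<lambda>t. c * g i t) \<in> o[at_top](g i)" "c \<noteq> 0"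
  then have "g i \<in> o[at_top](g i)" by simp
  then have "\<forall>\<^sub>F t in at_top. g i t = 0"
    using landau_o.small_refl_iff by blast
  with ev_nonzero[OF i] have "\<forall>\<^sub>F t in at_top::real filter. False"
    by eventually_elim simp
  then show False by simp
qed

text \<open>After the coefficients before \<open>j\<close> are removed, \<open>g j\<close> dominates
  all remaining terms. The error bound \<open>g i\<close> with general \<open>i\<close> matters:
  \<open>i = n - 1\<close> gives uniqueness of the matrices, smaller \<open>i\<close> gives their
  triangularity.\<close>

lemma coeff_zero:
  assumes "i < n" "(\<lambda>t. \<Sum>j<n. c j * g j t) \<in> o[at_top](g i)" "j \<le> i"
  shows "c j = 0"
  using assms(3)
proof (induction j rule: less_induct)
  case (less j)
  have jn: "j < n" using less.prems assms(1) by simp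
  have "(\<Sum>k<n. c k * g k t) = c j * g j t + (\<Sum>k\<in>{j<..<n}. c k * g k t)" for t
  proof -
    have "(\<Sum>k<n. c k * g k t) = (\<Sum>k\<in>{j..<n}. c k * g k t)"
      using less jn by (intro sum.mono_neutral_right) auto
    also have "{j..<n} = insert j {j<..<n}" using jn by auto
    finally show ?thesis by simp
  qed
  then have eq: "(\<lambda>t. c j * g j t) = (\<lambda>t. (\<Sum>k<n. c k * g k t) - (\<Sum>k\<in>{j<..<n}. c k * g k t))"
    by (simp add: fun_eq_iff)
  have "(\<lambda>t. \<Sum>k<n. c k * g k t) \<in> o[at_top](g j)"
    using assms(2) bigo_le[OF less.prems assms(1)] by (rule landau_o.small_big_trans)
  moreover have "(\<lambda>t. \<Sum>k\<in>{j<..<n}. c k * g k t) \<in> o[at_top](g j)"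
    by (intro big_sum_in_smallo) (auto intro: smallo_less)
  ultimately have "(\<lambda>t. c j * g j t) \<in> o[at_top](g j)"
    unfolding eq by (rule sum_in_smallo)
  then show ?case using not_smallo_self jn by blast
qed

text \<open>Coefficient functions replace matrices here, so that no carrier or dimension conditions
  arise; \<open>scales_by_iff\<close> translates back.\<close>

definition scales :: "real \<Rightarrow> (nat \<Rightarrow> nat \<Rightarrow> real) \<Rightarrow> bool" where
  "scales x A \<longleftrightarrow> (\<forall>i<n. (\<lambda>t. g i (x * t) - (\<Sum>j<n. A i j * g j t)) \<in> o[at_top](g (n - 1)))"

lemma scalesD: "scales x A \<Longrightarrow> i < n \<Longrightarrow>
    (\<lambda>t. g i (x * t) - (\<Sum>j<n. A i j * g j t)) \<in> o[at_top](g (n - 1))"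
  by (simp add: scales_def)

lemma scales_unique:
  assumes "scales x A" "scales x C" "i < n" "j < n"
  shows "A i j = C i j"
proof -
  have "(\<lambda>t. (g i (x * t) - (\<Sum>j<n. C i j * g j t)) - (g i (x * t) - (\<Sum>j<n. A i j * g j t)))
          \<in> o[at_top](g (n - 1))"
    using assms by (intro sum_in_smallo scalesD)
  also have "(\<lambda>t. (g i (x * t) - (\<Sum>j<n. C i j * g j t)) - (g i (x * t) - (\<Sum>j<n. A i j * g j t)))
      = (\<lambda>t. \<Sum>j<n. (A i j - C i j) * g j t)"
    by (simp add: fun_eq_iff algebra_simps sum_subtractf)
  finally have "A i j - C i j = 0"
    using assms by (intro coeff_zero[of "n - 1"]) auto
  then show ?thesis by simp
qed

lemma scales_one: "scales 1 (\<lambda>i j. if i = j then 1 else 0)"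
  by (simp add: scales_def if_distrib[of "\<lambda>c. c * _"] sum.delta' cong: if_cong)

lemma smallo_dilate:
  fixes f h :: "real \<Rightarrow> real"
  assumes "f \<in> o[at_top](h)" "x > 0"
  shows "(\<lambda>t. f (x * t)) \<in> o[at_top](\<lambda>t. h (x * t))"
  by (rule landau_o.small.compose[OF assms(1)])
     (use assms(2) in \<open>auto intro!: filterlim_tendsto_pos_mult_at_top filterlim_ident tendsto_const\<close>)

text \<open>The two claims feed each other: the O-bound for row \<open>i\<close> makes the next
  dilated component o(g_i), which kills the entries left of the diagonal in row i + 1, and this in
  turn gives the O-bound for that row.\<close>

lemma scales_triangular:
  assumes "scales x A" "x > 0" "i < n"
  shows "(\<forall>j<i. A i j = 0) \<and> (\<lambda>t. g i (x * t)) \<in> O[at_top](g i)"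
  using assms(3)
proof (induction i)
  case 0
  have "(\<lambda>t. g 0 (x * t) - (\<Sum>j<n. A 0 j * g j t)) \<in> O[at_top](g 0)"
    by (intro landau_o.small_imp_big smallo_last[OF 0] scalesD[OF assms(1) 0])
  moreover have "(\<lambda>t. \<Sum>j<n. A 0 j * g j t) \<in> O[at_top](g 0)"
    by (intro big_sum_in_bigo) (simp add: bigo_le)
  ultimately have "(\<lambda>t. (g 0 (x * t) - (\<Sum>j<n. A 0 j * g j t)) + (\<Sum>j<n. A 0 j * g j t)) \<in> O[at_top](g 0)"
    by (rule sum_in_bigo)
  then show ?case by simp
next
  case (Suc i)
  have "(\<lambda>t. g (Suc i) (x * t)) \<in> o[at_top](\<lambda>t. g i (x * t))"
    using Suc.prems assms(2) by (intro smallo_dilate step)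
  then have small: "(\<lambda>t. g (Suc i) (x * t)) \<in> o[at_top](g i)"
    using Suc by (auto intro: landau_o.small_big_trans)
  have rem: "(\<lambda>t. g (Suc i) (x * t) - (\<Sum>j<n. A (Suc i) j * g j t)) \<in> o[at_top](g (n - 1))"
    by (rule scalesD[OF assms(1) Suc.prems])
  have "(\<lambda>t. g (Suc i) (x * t) - (g (Suc i) (x * t) - (\<Sum>j<n. A (Suc i) j * g j t))) \<in> o[at_top](g i)"
    using Suc.prems by (intro sum_in_smallo(2)[OF small smallo_last[OF _ rem]]) simp
  then have "(\<lambda>t. \<Sum>j<n. A (Suc i) j * g j t) \<in> o[at_top](g i)" by simp
  then have zero: "A (Suc i) j = 0" if "j < Suc i" for j
    using that Suc.prems by (intro coeff_zero[of i]) auto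
  have "(\<lambda>t. A (Suc i) j * g j t) \<in> O[at_top](g (Suc i))" if "j < n" for j
    using zero[of j] that bigo_le[of "Suc i" j] by (cases "j < Suc i") auto
  then have "(\<lambda>t. \<Sum>j<n. A (Suc i) j * g j t) \<in> O[at_top](g (Suc i))"
    by (intro big_sum_in_bigo) auto
  with landau_o.small_imp_big[OF smallo_last[OF Suc.prems rem]]
  have "(\<lambda>t. (g (Suc i) (x * t) - (\<Sum>j<n. A (Suc i) j * g j t)) + (\<Sum>j<n. A (Suc i) j * g j t))
      \<in> O[at_top](g (Suc i))"
    by (rule sum_in_bigo)
  then have "(\<lambda>t. g (Suc i) (x * t)) \<in> O[at_top](g (Suc i))" by simp
  then show ?case using zero by simp
qed

text \<open>The remainder for x, evaluated at y t, is small only relative to the last rate at y t;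
  the O-bound in \<open>scales_triangular\<close> for the last component brings it back to the rate
  at t.\<close>

lemma scales_mult:
  assumes A: "scales x A" "x > 0" and C: "scales y C" "y > 0"
  shows "scales (x * y) (\<lambda>i k. \<Sum>j<n. A i j * C j k)"
  unfolding scales_def
proof (intro allI impI)
  fix i assume i: "i < n"
  let ?R = "\<lambda>t. g i (x * (y * t)) - (\<Sum>j<n. A i j * g j (y * t))"
  let ?Q = "\<lambda>t. \<Sum>j<n. A i j * (g j (y * t) - (\<Sum>k<n. C j k * g k t))"
  have "?R \<in> o[at_top](\<lambda>t. g (n - 1) (y * t))"
    by (rule smallo_dilate[OF scalesD[OF A(1) i] C(2)])
  then have R: "?R \<in> o[at_top](g (n - 1))"
    using scales_triangular[OF C, of "n - 1"] n_pos by (auto intro: landau_o.small_big_trans)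
  have Q: "?Q \<in> o[at_top](g (n - 1))"
    using scalesD[OF C(1)] by (intro big_sum_in_smallo) simp
  have "g i (x * y * t) - (\<Sum>k<n. (\<Sum>j<n. A i j * C j k) * g k t) = ?R t + ?Q t" for t
  proof -
    have "(\<Sum>k<n. (\<Sum>j<n. A i j * C j k) * g k t) = (\<Sum>j<n. \<Sum>k<n. A i j * C j k * g k t)"
      unfolding sum_distrib_right by (rule sum.swap)
    also have "\<dots> = (\<Sum>j<n. A i j * (\<Sum>k<n. C j k * g k t))"
      by (simp add: sum_distrib_left mult.assoc)
    finally show ?thesis
      by (simp add: right_diff_distrib sum_subtractf mult.assoc)
  qed
  then show "(\<lambda>t. g i (x * y * t) - (\<Sum>k<n. (\<Sum>j<n. A i j * C j k) * g k t)) \<in> o[at_top](g (n - 1))"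
    using sum_in_smallo(1)[OF R Q] by simp
qed

text \<open>Recovers the entries of a row one column at a time: subtracting the earlier columns
  makes \<open>g j\<close> the leading scale. This formula is what carries measurability over to the
  matrices.\<close>

lemma scales_limit:
  assumes "scales x A" "i < n" "j < n"
  shows "((\<lambda>t. (g i (x * t) - (\<Sum>l<j. A i l * g l t)) / g j t) \<longlongrightarrow> A i j) at_top"
proof -
  let ?f = "\<lambda>t. (g i (x * t) - (\<Sum>l<n. A i l * g l t)) + (\<Sum>l\<in>{j<..<n}. A i l * g l t)"
  have "?f \<in> o[at_top](g j)"
    using scalesD[OF assms(1,2)] smallo_last[OF assms(3)]
    by (intro sum_in_smallo(1) big_sum_in_smallo) (auto intro: smallo_less)
  then have "((\<lambda>t. ?f t / g j t + A i j) \<longlongrightarrow> 0 + A i j) at_top"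
    by (intro tendsto_add smalloD_tendsto tendsto_const)
  then have lim: "((\<lambda>t. ?f t / g j t + A i j) \<longlongrightarrow> A i j) at_top" by simp
  have split: "(\<Sum>l<n. A i l * g l t) = (\<Sum>l<j. A i l * g l t) + A i j * g j t + (\<Sum>l\<in>{j<..<n}. A i l * g l t)" for t
  proof -
    have "{..<n} = {..<j} \<union> insert j {j<..<n}" using assms(3) by auto
    moreover have "(\<Sum>l\<in>{..<j} \<union> insert j {j<..<n}. A i l * g l t)
        = (\<Sum>l<j. A i l * g l t) + (\<Sum>l\<in>insert j {j<..<n}. A i l * g l t)"
      by (intro sum.union_disjoint) auto
    ultimately show ?thesis by simp
  qed
  have "\<forall>\<^sub>F t in at_top. ?f t / g j t + A i j = (g i (x * t) - (\<Sum>l<j. A i l * g l t)) / g j t"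
    using ev_nonzero[OF assms(3)] by eventually_elim (simp add: split field_simps)
  with lim show ?thesis by (rule Lim_transform_eventually)
qed

text \<open>The quotient for column \<open>j\<close> contains the entries of the earlier columns,
  hence the induction on \<open>j\<close>. The limit is taken along integers to have a countable
  sequence, and \<open>G\<close> is used because x k ranges beyond the domain of the
  component.\<close>

lemma scales_measurable:
  assumes A: "\<And>x. x > 0 \<Longrightarrow> scales x (A x)"
    and G: "G i \<in> borel_measurable lebesgue" "\<forall>\<^sub>F t in at_top. G i t = g i t"
    and "i < n" "j < n"
  shows "(\<lambda>x. A x i j) \<in> borel_measurable (lebesgue_on {0<..})"
  using \<open>j < n\<close>
proof (induction j rule: less_induct)
  case (less j)
  show ?case
  proof (rule borel_measurable_LIMSEQ_real)
    fix k :: nat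
    have "(\<lambda>x. G i (x * real k)) \<in> borel_measurable lebesgue"
      using measurable_comp[OF lebesgue_measurable_scaling[of "real k"] G(1)]
      by (simp add: o_def mult.commute)
    then have "(\<lambda>x. G i (x * real k)) \<in> borel_measurable (lebesgue_on {0<..})"
      by (rule measurable_restrict_space1)
    then show "(\<lambda>x. (G i (x * real k) - (\<Sum>l<j. A x i l * g l (real k))) / g j (real k))
        \<in> borel_measurable (lebesgue_on {0<..})"
      using less by (intro borel_measurable_divide borel_measurable_diff borel_measurable_sum
          borel_measurable_times borel_measurable_const) auto
  next
    fix x :: real assume "x \<in> space (lebesgue_on {0<..})"
    then have x: "x > 0" by (simp add: space_restrict_space)
    have fl: "filterlim (\<lambda>t::real. x * t) at_top at_top"
      using x by (auto intro!: filterlim_tendsto_pos_mult_at_top filterlim_ident tendsto_const)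
    have "\<forall>\<^sub>F t in at_top. G i (x * t) = g i (x * t)"
      using G(2) fl by (rule eventually_compose_filterlim)
    then have "\<forall>\<^sub>F t in at_top. (g i (x * t) - (\<Sum>l<j. A x i l * g l t)) / g j t
        = (G i (x * t) - (\<Sum>l<j. A x i l * g l t)) / g j t"
      by eventually_elim simp
    with scales_limit[OF A[OF x] \<open>i < n\<close> less.prems]
    have "((\<lambda>t. (G i (x * t) - (\<Sum>l<j. A x i l * g l t)) / g j t) \<longlongrightarrow> A x i j) at_top"
      by (rule Lim_transform_eventually)
    then show "(\<lambda>k. (G i (x * real k) - (\<Sum>l<j. A x i l * g l (real k))) / g j (real k)) \<longlonglongrightarrow> A x i j"
      by (rule filterlim_compose) (rule filterlim_real_sequentially)
  qed
qed

end

section \<open>Measurable triangular matrix homomorphisms\<close>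

lemma mult_mat_index_sum:
  fixes A B :: "'a :: semiring_0 mat"
  assumes "A \<in> carrier_mat n n" "B \<in> carrier_mat n n" "i < n" "j < n"
  shows "(A * B) $$ (i, j) = (\<Sum>k<n. A $$ (i, k) * B $$ (k, j))"
  using assms by (simp add: scalar_prod_def atLeast0LessThan)

lemma pow_smult_mat_index:
  fixes A :: "'a :: comm_semiring_1 mat"
  assumes A: "A \<in> carrier_mat n n"
  shows "i < n \<Longrightarrow> j < n \<Longrightarrow> ((c \<cdot>\<^sub>m A) ^\<^sub>m k) $$ (i, j) = c ^ k * (A ^\<^sub>m k) $$ (i, j)"
proof (induction k arbitrary: j)
  case (Suc k)
  have "((c \<cdot>\<^sub>m A) ^\<^sub>m Suc k) $$ (i, j) = (\<Sum>l<n. ((c \<cdot>\<^sub>m A) ^\<^sub>m k) $$ (i, l) * (c \<cdot>\<^sub>m A) $$ (l, j))"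
    using mult_mat_index_sum[of "(c \<cdot>\<^sub>m A) ^\<^sub>m k" n "c \<cdot>\<^sub>m A" i j] A Suc.prems by simp
  also have "\<dots> = c ^ Suc k * (\<Sum>l<n. (A ^\<^sub>m k) $$ (i, l) * A $$ (l, j))"
    using A Suc by (simp add: sum_distrib_left algebra_simps)
  also have "(\<Sum>l<n. (A ^\<^sub>m k) $$ (i, l) * A $$ (l, j)) = (A ^\<^sub>m Suc k) $$ (i, j)"
    using mult_mat_index_sum[of "A ^\<^sub>m k" n A i j] A Suc.prems by simp
  finally show ?case .
qed (use A in simp)

lemma upper_triangular_right_inverse:
  fixes C :: "nat \<Rightarrow> nat \<Rightarrow> 'a :: field"
  assumes "\<And>i j. i < n \<Longrightarrow> j < i \<Longrightarrow> C i j = 0" "\<And>i. i < n \<Longrightarrow> C i i \<noteq> 0"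
  obtains C' where "\<And>i j. i < n \<Longrightarrow> j < n \<Longrightarrow> (\<Sum>k<n. C i k * C' k j) = (if i = j then 1 else 0)"
proof -
  define M where "M = Matrix.mat n n (\<lambda>(i, j). C i j)"
  have M: "M \<in> carrier_mat n n" "upper_triangular M"
    using assms(1) by (auto simp: M_def)
  have "0 \<notin> set (diag_mat M)"
    using assms(2) by (auto simp: M_def diag_mat_def)
  then have "det M \<noteq> 0"
    using upper_triangular_imp_det_eq_0_iff[OF M] by simp
  then obtain N where N: "N \<in> carrier_mat n n" "M * N = 1\<^sub>m n"
    using det_non_zero_imp_unit[OF M(1)] by (auto simp: Units_def ring_mat_def)
  show ?thesis
  proof (rule that[of "\<lambda>k j. N $$ (k, j)"])
    fix i j assume ij: "i < n" "j < n"
    have "(\<Sum>k<n. C i k * N $$ (k, j)) = (M * N) $$ (i, j)"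
      using M(1) N(1) ij by (subst mult_mat_index_sum) (auto simp: M_def)
    then show "(\<Sum>k<n. C i k * N $$ (k, j)) = (if i = j then 1 else 0)"
      using N ij by simp
  qed
qed

text \<open>Intended for the diagonal entries before they are known to be continuous: no positive
  lower bound on a subinterval is available, so a vanishing integral is excluded almost everywhere
  instead.\<close>

lemma integral_pos_real:
  fixes f :: "real \<Rightarrow> real"
  assumes f: "f integrable_on {a..b}" and "a < b" and pos: "\<And>y. y \<in> {a..b} \<Longrightarrow> f y > 0"
  shows "integral {a..b} f > 0"
proof -
  let ?h = "\<lambda>x. indicator {a..b} x *\<^sub>R f x"
  have abs: "f absolutely_integrable_on {a..b}"
    using f pos by (intro nonnegative_absolutely_integrable_1) (auto intro: less_imp_le)
  then have h: "integrable lebesgue ?h" by (simp add: set_integrable_def)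
  have nonneg: "0 \<le> ?h x" for x using pos[of x] by (auto simp: indicator_def)
  have eq: "integral\<^sup>L lebesgue ?h = integral {a..b} f"
    using set_lebesgue_integral_eq_integral(2)[OF abs] by (simp add: set_lebesgue_integral_def)
  have "integral\<^sup>L lebesgue ?h \<noteq> 0"
  proof
    assume "integral\<^sup>L lebesgue ?h = 0"
    then have "AE x in lebesgue. ?h x = 0"
      using integral_nonneg_eq_0_iff_AE[OF h] nonneg by simp
    then have "AE x in lebesgue. x \<notin> {a..b}"
      by eventually_elim (use pos in \<open>force simp: indicator_def\<close>)
    then have "{a..b} \<in> null_sets lebesgue"
      by (subst AE_iff_null_sets) auto
    then show False using \<open>a < b\<close> by (simp add: null_sets_def)
  qed
  moreover have "integral\<^sup>L lebesgue ?h \<ge> 0" using nonneg by (rule Bochner_Integration.integral_nonneg)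
  ultimately show ?thesis using eq by simp
qed

locale triangular_hom =
  fixes n :: nat and a :: "real \<Rightarrow> nat \<Rightarrow> nat \<Rightarrow> real"
  assumes hom_mult: "\<lbrakk>x > 0; y > 0; i < n; k < n\<rbrakk> \<Longrightarrow> a (x * y) i k = (\<Sum>j<n. a x i j * a y j k)"
    and hom_one: "\<lbrakk>i < n; j < n\<rbrakk> \<Longrightarrow> a 1 i j = (if i = j then 1 else 0)"
    and hom_tri: "\<lbrakk>x > 0; i < n; j < i\<rbrakk> \<Longrightarrow> a x i j = 0"
    and hom_meas: "\<lbrakk>i < n; j < n\<rbrakk> \<Longrightarrow> (\<lambda>x. a x i j) \<in> borel_measurable (lebesgue_on {0<..})"
begin

section \<open>Positive diagonal and local boundedness\<close>

lemma hom_diag_mult: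
  assumes "x > 0" "y > 0" "i < n"
  shows "a (x * y) i i = a x i i * a y i i"
proof -
  have "a x i j * a y j i = 0" if "j < n" "j \<noteq> i" for j
    using that assms hom_tri[of x i j] hom_tri[of y j i] by (cases "j < i") auto
  then have "(\<Sum>j<n. a x i j * a y j i) = (\<Sum>j\<in>{i}. a x i j * a y j i)"
    using assms by (intro sum.mono_neutral_right) auto
  then show ?thesis using hom_mult[of x y i i] assms by simp
qed

lemma hom_diag_pos:
  assumes "x > 0" "i < n"
  shows "a x i i > 0"
proof -
  have "a x i i = (a (sqrt x) i i)\<^sup>2"
    using hom_diag_mult[of "sqrt x" "sqrt x" i] assms by (simp add: power2_eq_square)
  moreover have "a x i i * a (1/x) i i = 1"
    using hom_diag_mult[of x "1/x" i] hom_one[of i i] assms by simp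
  then have "a x i i \<noteq> 0" by auto
  ultimately show ?thesis by (simp add: less_le)
qed

text \<open>The sets \<open>E M\<close> exhaust [1, 2], so one of them has positive measure. Its
  products fill a multiplicative interval, where the entries are at most n M^2, and a fixed left
  factor carries that interval to any point \<open>w\<close>.\<close>

lemma hom_locally_bounded:
  obtains q where "q > 1" "\<And>w. w > 0 \<Longrightarrow> \<exists>C. \<forall>x i j. w / q < x \<longrightarrow> x < w * q \<longrightarrow> i < n \<longrightarrow> j < n \<longrightarrow> \<bar>a x i j\<bar> \<le> C"
proof -
  define E where "E M = {x \<in> {1..2}. \<forall>i<n. \<forall>j<n. \<bar>a x i j\<bar> \<le> real M}" for M :: nat
  have Em: "E M \<in> sets lebesgue" for M
  proof -
    have sub: "{1..2::real} \<subseteq> {0<..}" by auto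
    have m: "(\<lambda>x. a x i j) \<in> borel_measurable (lebesgue_on {1..2})" if "i < n" "j < n" for i j
      using hom_meas[OF that] sub by (rule measurable_restrict_mono)
    have "{x \<in> space (lebesgue_on {1..2}). \<forall>i\<in>{..<n}. \<forall>j\<in>{..<n}. \<bar>a x i j\<bar> \<le> real M} \<in> sets (lebesgue_on {1..2})"
      using m by (intro sets.sets_Collect_finite_All borel_measurable_le borel_measurable_abs borel_measurable_const) auto
    moreover have "{x \<in> space (lebesgue_on {1..2}). \<forall>i\<in>{..<n}. \<forall>j\<in>{..<n}. \<bar>a x i j\<bar> \<le> real M} = E M"
      by (auto simp: E_def space_restrict_space)
    ultimately have "E M \<in> sets (lebesgue_on {1..2})" by metis
    then show ?thesis
      using sets_restrict_space_iff[of "{1..2}" lebesgue "E M"] by auto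
  qed
  have cover: "{1..2} \<subseteq> (\<Union>M. E M)"
  proof
    fix x :: real assume x: "x \<in> {1..2}"
    define m where "m = (\<Sum>i<n. \<Sum>j<n. \<bar>a x i j\<bar>)"
    have "\<bar>a x i j\<bar> \<le> m" if "i < n" "j < n" for i j
    proof -
      have "\<bar>a x i j\<bar> \<le> (\<Sum>j<n. \<bar>a x i j\<bar>)" using that by (intro member_le_sum) auto
      also have "\<dots> \<le> m" unfolding m_def using that
        by (intro member_le_sum[of _ _ "\<lambda>i. \<Sum>j<n. \<bar>a x i j\<bar>"]) (auto intro: sum_nonneg)
      finally show ?thesis .
    qed
    moreover obtain M :: nat where "m \<le> real M" using real_arch_simple by blast
    ultimately have "x \<in> E M" using x by (auto simp: E_def intro: order_trans)
    then show "x \<in> (\<Union>M. E M)" by blast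
  qed
  have "\<exists>M. emeasure lebesgue (E M) > 0"
  proof (rule ccontr)
    assume "\<not> ?thesis"
    then have "E M \<in> null_sets lebesgue" for M using Em by (simp add: null_setsI not_gr_zero)
    then have "(\<Union>M. E M) \<in> null_sets lebesgue" by (rule null_sets_UN)
    then have "negligible (\<Union>M. E M)" by (simp add: negligible_iff_null_sets)
    then have "negligible {1..2::real}" using cover by (rule negligible_subset)
    then show False by (simp add: negligible_iff_measure)
  qed
  then obtain M where M: "emeasure lebesgue (E M) > 0" by blast
  obtain u v where uv: "u < v" "\<forall>z\<in>{u<..<v}. \<exists>b\<in>E M. \<exists>c\<in>E M. exp z = b * c"
  proof -
    have "E M \<subseteq> {0<..}" by (auto simp: E_def)
    from exp_interval_mult_closure[OF Em M this] show ?thesis using that by blast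
  qed
  define K where "K = real n * (real M * real M)"
  have bd: "\<bar>a (exp z) i j\<bar> \<le> K" if z: "z \<in> {u<..<v}" and ij: "i < n" "j < n" for z i j
  proof -
    obtain b c where bc: "b \<in> E M" "c \<in> E M" "exp z = b * c" using uv(2) z by blast
    then have "a (exp z) i j = (\<Sum>l<n. a b i l * a c l j)"
      using ij by (auto simp: E_def intro!: hom_mult)
    also have "\<bar>\<dots>\<bar> \<le> (\<Sum>l<n. real M * real M)"
      using bc ij by (intro order_trans[OF sum_abs] sum_mono) (auto simp: abs_mult E_def intro!: mult_mono)
    finally show ?thesis by (simp add: K_def)
  qed
  \<comment> \<open>\<open>m\<close> is the midpoint and ln \<open>q\<close> the half-length of the
    logarithmic interval, so dividing the neighbourhood of \<open>w\<close> by w exp(-m) lands it in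
    the range exp(u) to exp(v).\<close>
  define m where "m = (u + v) / 2"
  define q where "q = exp ((v - u) / 2)"
  show ?thesis
  proof (rule that[of q])
    show "q > 1" using uv(1) by (simp add: q_def)
    fix w :: real assume w: "w > 0"
    define W where "W = (\<Sum>i<n. \<Sum>j<n. \<bar>a (w * exp (-m)) i j\<bar>)"
    have "\<bar>a x i j\<bar> \<le> real n * (W * K)" if x: "w / q < x" "x < w * q" and ij: "i < n" "j < n" for x i j
    proof -
      have q: "q > 0" by (simp add: q_def)
      have "w / q > 0" using w q by simp
      then have x0: "x > 0" using x(1) by linarith
      define z where "z = ln (x * exp m / w)"
      have ez: "exp z = x * exp m / w" using x0 w by (simp add: z_def)
      have "z = ln x - ln w + m" using x0 w by (simp add: z_def ln_div ln_mult)
      moreover have "ln (w / q) < ln x" "ln x < ln (w * q)" using x x0 w q by (auto intro!: ln_less_cancel_iff[THEN iffD2])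
      then have "ln w - (v - u) / 2 < ln x" "ln x < ln w + (v - u) / 2"
        using w q by (simp_all add: ln_div ln_mult q_def)
      ultimately have "u < z \<and> z < v" unfolding m_def by argo
      then have "z \<in> {u<..<v}" by simp
      note bz = bd[OF this]
      have "x = (w * exp (-m)) * exp z" using w by (simp add: ez exp_minus)
      then have "a x i j = a ((w * exp (-m)) * exp z) i j"
        by (rule arg_cong[where f = "\<lambda>x. a x i j"])
      also have "\<dots> = (\<Sum>l<n. a (w * exp (-m)) i l * a (exp z) l j)"
        by (rule hom_mult) (use w ij in auto)
      finally have eq: "a x i j = (\<Sum>l<n. a (w * exp (-m)) i l * a (exp z) l j)" .
      have "\<bar>a x i j\<bar> \<le> (\<Sum>l<n. W * K)"
        unfolding eq
      proof (rule order_trans[OF sum_abs], rule sum_mono)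
        fix l assume "l \<in> {..<n}"
        then have l: "l < n" by simp
        have W0: "0 \<le> W" unfolding W_def by (intro sum_nonneg) auto
        have "\<bar>a (w * exp (-m)) i l\<bar> \<le> (\<Sum>j<n. \<bar>a (w * exp (-m)) i j\<bar>)"
          by (rule member_le_sum) (use l in auto)
        also have "\<dots> \<le> W" unfolding W_def
          by (rule member_le_sum[of i _ "\<lambda>i. \<Sum>j<n. \<bar>a (w * exp (-m)) i j\<bar>"])
             (use ij in \<open>auto intro: sum_nonneg\<close>)
        finally have "\<bar>a (w * exp (-m)) i l\<bar> * \<bar>a (exp z) l j\<bar> \<le> W * K"
          by (rule mult_mono) (use W0 bz[OF l ij(2)] in auto)
        then show "\<bar>a (w * exp (-m)) i l * a (exp z) l j\<bar> \<le> W * K"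
          by (simp only: abs_mult)
      qed
      then show ?thesis by simp
    qed
    then show "\<exists>C. \<forall>x i j. w / q < x \<longrightarrow> x < w * q \<longrightarrow> i < n \<longrightarrow> j < n \<longrightarrow> \<bar>a x i j\<bar> \<le> C" by blast
  qed
qed

text \<open>
  Averaging the homomorphism law over \<open>[1, r]\<close> gives \<open>A(x) Q = x\<^sup>-\<^sup>1 \<integral> A\<close> over \<open>[x, r x]\<close>, where
  \<open>Q\<close> is triangular with positive diagonal; the right-hand side is smoother than \<open>A\<close>.
\<close>
lemma hom_as_average:
  assumes r: "r > 1" and int: "\<And>i j. i < n \<Longrightarrow> j < n \<Longrightarrow> (\<lambda>x. a x i j) integrable_on {1..r}"
  obtains Q' where "\<And>x i j. \<lbrakk>x > 0; i < n; j < n\<rbrakk> \<Longrightarrow>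
    a x i j = (\<Sum>k<n. (1 / x) * integral {x..x * r} (\<lambda>y. a y i k) * Q' k j)"
proof -
  define Q where "Q i j = integral {1..r} (\<lambda>y. a y i j)" for i j
  have conv: "(1 / x) * integral {x..x * r} (\<lambda>y. a y i k) = (\<Sum>j<n. a x i j * Q j k)"
    if x: "x > 0" and ik: "i < n" "k < n" for x i k
  proof -
    have "(\<lambda>y. y / x) ` {x..x * r} = {1..r}"
      using x r by (auto simp: image_divide_atLeastAtMost)
    then have "(1 / x) * integral {x..x * r} (\<lambda>y. a y i k) = integral {1..r} (\<lambda>y. a (x * y) i k)"
      using integral_stretch_real[of x x "x * r" "\<lambda>y. a y i k"] x by simp
    also have "\<dots> = integral {1..r} (\<lambda>y. \<Sum>j<n. a x i j * a y j k)"
      using x ik by (intro integral_cong hom_mult) auto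
    also have "\<dots> = (\<Sum>j<n. integral {1..r} (\<lambda>y. a x i j * a y j k))"
      using ik by (intro integral_sum integrable_on_mult_right int) auto
    also have "\<dots> = (\<Sum>j<n. a x i j * Q j k)"
      by (simp add: Q_def)
    finally show ?thesis .
  qed
  have Qtri: "Q i j = 0" if "i < n" "j < i" for i j
  proof -
    have "Q i j = integral {1..r} (\<lambda>y. 0::real)"
      unfolding Q_def using that by (intro integral_cong hom_tri) auto
    then show ?thesis by simp
  qed
  have Qdiag: "Q i i \<noteq> 0" if i: "i < n" for i
  proof -
    have "Q i i > 0"
      unfolding Q_def using r i by (intro integral_pos_real int hom_diag_pos) auto
    then show ?thesis by simp
  qed
  obtain Q' where Q': "\<And>i j. i < n \<Longrightarrow> j < n \<Longrightarrow> (\<Sum>k<n. Q i k * Q' k j) = (if i = j then 1 else 0)"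
    by (rule upper_triangular_right_inverse[of n Q]) (use Qtri Qdiag in auto)
  show ?thesis
  proof (rule that[of Q'])
    fix x :: real and i j assume x: "x > 0" and ij: "i < n" "j < n"
    have "(\<Sum>k<n. (1 / x) * integral {x..x * r} (\<lambda>y. a y i k) * Q' k j)
        = (\<Sum>k<n. (\<Sum>l<n. a x i l * Q l k) * Q' k j)"
      using conv[OF x ij(1)] by (intro sum.cong) auto
    also have "\<dots> = (\<Sum>l<n. \<Sum>k<n. a x i l * Q l k * Q' k j)"
      unfolding sum_distrib_right by (rule sum.swap)
    also have "\<dots> = (\<Sum>l<n. a x i l * (\<Sum>k<n. Q l k * Q' k j))"
      by (simp add: sum_distrib_left mult.assoc)
    also have "\<dots> = (\<Sum>l<n. a x i l * (if l = j then 1 else 0))"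
      using Q' ij by (intro sum.cong) auto
    also have "\<dots> = (\<Sum>l<n. if l = j then a x i l else 0)"
      by (intro sum.cong) auto
    also have "\<dots> = a x i j" using ij by simp
    finally show "a x i j = (\<Sum>k<n. (1 / x) * integral {x..x * r} (\<lambda>y. a y i k) * Q' k j)" by simp
  qed
qed

text \<open>First averaging step: bounded measurable entries are integrable, and an integral over a
  moving window is continuous in its endpoints.\<close>

lemma hom_isCont_one:
  assumes "i < n" "j < n"
  shows "isCont (\<lambda>x. a x i j) 1"
proof -
  obtain q where q: "q > 1" and qb: "\<And>w. w > 0 \<Longrightarrow> \<exists>C. \<forall>x i j. w / q < x \<longrightarrow> x < w * q \<longrightarrow> i < n \<longrightarrow> j < n \<longrightarrow> \<bar>a x i j\<bar> \<le> C"
    using hom_locally_bounded by blast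
  \<comment> \<open>With r^3 = q, the windows [x, r x] for x in [1/r, r] stay in
    [\<open>p\<close>, \<open>P\<close>] = [1/r^2, r^2], strictly inside the range (1/q, q) where a
    bound is known.\<close>
  define r where "r = root 3 q"
  have r: "r > 1" "r ^ 3 = q" using q by (auto simp: r_def)
  define p where "p = 1 / r\<^sup>2"
  define P where "P = r\<^sup>2"
  have r2: "r\<^sup>2 < q" "r\<^sup>2 > 1" "r\<^sup>2 > r"
    using r by (auto simp: power_strict_increasing simp flip: r(2)) (simp add: power2_eq_square)
  have pP: "0 < p" "p < 1/r" "1/r < 1" "1 < r" "r < P" "1/q < p" "P < q" "r * r = P"
    using r r2 by (auto simp: p_def P_def frac_less2 power2_eq_square)
  then have p1: "p \<le> 1" by linarith
  obtain C where C: "\<And>x i j. 1 / q < x \<Longrightarrow> x < 1 * q \<Longrightarrow> i < n \<Longrightarrow> j < n \<Longrightarrow> \<bar>a x i j\<bar> \<le> C"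
    using qb[of 1] by auto
  have int: "(\<lambda>x. a x i j) integrable_on {p..P}" if ij: "i < n" "j < n" for i j
  proof (rule measurable_bounded_by_integrable_imp_integrable[where g = "\<lambda>_. C"])
    have "{p..P} \<subseteq> {0<..}" using pP by auto
    with hom_meas[OF ij] show "(\<lambda>x. a x i j) \<in> borel_measurable (lebesgue_on {p..P})"
      by (rule measurable_restrict_mono)
    show "norm (a x i j) \<le> C" if "x \<in> {p..P}" for x
      using C[of x i j] that ij pP by auto
  qed auto
  have int': "(\<lambda>x. a x i j) integrable_on {b..c}" if "i < n" "j < n" "p \<le> b" "c \<le> P" for i j b c
    using that by (intro integrable_on_subinterval[OF int]) auto
  define \<Phi> where "\<Phi> x i j = integral {x..x * r} (\<lambda>y. a y i j)" for x i j
  obtain Q' where Q': "\<And>x i j. \<lbrakk>x > 0; i < n; j < n\<rbrakk> \<Longrightarrow> a x i j = (\<Sum>k<n. (1 / x) * \<Phi> x i k * Q' k j)"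
  proof (rule hom_as_average[OF r(1)])
    show "(\<lambda>x. a x i j) integrable_on {1..r}" if "i < n" "j < n" for i j
      using that pP p1 by (intro int') auto
  qed (auto simp: \<Phi>_def)
  have cF: "continuous_on {1/r..r} (\<lambda>x. \<Phi> x i k)" if "k < n" for k
  proof -
    let ?F = "\<lambda>x. integral {p..x} (\<lambda>y. a y i k)"
    have F: "continuous_on {p..P} ?F"
      using int[OF assms(1) that] by (rule indefinite_integral_continuous_1)
    have "\<Phi> x i k = ?F (x * r) - ?F x" if "x \<in> {1/r..r}" for x
    proof -
      have "x * r \<le> P" using mult_right_mono[of x r r] that r(1) pP(8) by simp
      moreover have "x \<le> x * r" "p \<le> x" using that pP r(1) by auto
      ultimately have "?F x + \<Phi> x i k = ?F (x * r)"
        unfolding \<Phi>_def using assms(1) \<open>k < n\<close> by (intro integral_combine int') auto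
      then show ?thesis by simp
    qed
    moreover have "continuous_on {1/r..r} (\<lambda>x. ?F (x * r) - ?F x)"
    proof (intro continuous_on_diff)
      show "continuous_on {1/r..r} ?F" using pP by (intro continuous_on_subset[OF F]) auto
      have "(\<lambda>x. x * r) ` {1/r..r} \<subseteq> {p..P}"
      proof (clarsimp, intro conjI)
        fix x assume x: "1/r \<le> x" "x \<le> r"
        show "x * r \<le> P" using mult_right_mono[OF x(2), of r] r(1) pP(8) by simp
        have "1 \<le> x * r" using x r(1) by (simp add: field_simps)
        then show "p \<le> x * r" using pP by linarith
      qed
      then show "continuous_on {1/r..r} (\<lambda>x. ?F (x * r))"
        by (intro continuous_on_compose2[OF F] continuous_intros)
    qed
    ultimately show ?thesis by (subst continuous_on_cong[OF refl]) auto
  qed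
  have "continuous_on {1/r..r} (\<lambda>x. \<Sum>k<n. (1 / x) * \<Phi> x i k * Q' k j)"
    using pP by (intro continuous_on_sum continuous_on_mult continuous_on_divide continuous_on_const continuous_on_id cF) auto
  then have "continuous_on {1/r..r} (\<lambda>x. a x i j)"
    using Q'[OF _ assms] pP by (subst continuous_on_cong[OF refl]) (auto intro: order_less_le_trans)
  then have "continuous_on {1/r<..<r} (\<lambda>x. a x i j)"
    by (rule continuous_on_subset) auto
  then show ?thesis
    using pP by (simp add: continuous_on_eq_continuous_at)
qed

text \<open>Left translation: a(y) = a(x) a(y/x), with y/x close to 1.\<close>

lemma hom_isCont:
  assumes "x > 0" "i < n" "j < n"
  shows "isCont (\<lambda>x. a x i j) x"
proof -
  have "isCont (\<lambda>y. a y l j) (x / x)" if "l < n" for l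
    using hom_isCont_one[OF that assms(3)] assms(1) by simp
  then have "isCont (\<lambda>y. \<Sum>l<n. a x i l * a (y / x) l j) x"
    using assms(1) by (intro continuous_intros isCont_o2[of x "\<lambda>y. y / x"]) auto
  moreover have "\<forall>\<^sub>F y in nhds x. (\<Sum>l<n. a x i l * a (y / x) l j) = a y i j"
  proof (rule eventually_mono[OF eventually_nhds_in_open[of "{0::real<..}"]])
    fix y :: real assume "y \<in> {0<..}"
    then show "(\<Sum>l<n. a x i l * a (y / x) l j) = a y i j"
      using hom_mult[of x "y / x" i j] assms by simp
  qed (use assms(1) in auto)
  ultimately show ?thesis by (simp add: isCont_cong)
qed

text \<open>Second averaging step: the integrand is now continuous, so the moving integral is
  differentiable. The window ratio is 2; [1/2, 4] contains every window [x, 2 x] with x between 1/2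
  and 2.\<close>

lemma hom_differentiable_one:
  obtains b where "\<And>i j. i < n \<Longrightarrow> j < n \<Longrightarrow> ((\<lambda>x. a x i j) has_real_derivative b i j) (at 1)"
proof -
  have cont: "continuous_on {1/2..4} (\<lambda>x. a x i j)" if "i < n" "j < n" for i j
    using that by (intro continuous_at_imp_continuous_on ballI hom_isCont) auto
  have int: "(\<lambda>x. a x i j) integrable_on {c..d}" if "i < n" "j < n" "1/2 \<le> c" "d \<le> 4" for i j c d
    using that by (intro integrable_on_subinterval[OF integrable_continuous_real[OF cont]]) auto
  obtain Q' where Q': "\<And>x i j. \<lbrakk>x > 0; i < n; j < n\<rbrakk> \<Longrightarrow>
      a x i j = (\<Sum>k<n. (1 / x) * integral {x..x * 2} (\<lambda>y. a y i k) * Q' k j)"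
    using hom_as_average[of 2] int by auto
  have "\<exists>d. ((\<lambda>x. a x i j) has_real_derivative d) (at 1)" if ij: "i < n" "j < n" for i j
  proof -
    let ?F = "\<lambda>k x. integral {1/2..x} (\<lambda>y. a y i k)"
    have F: "(?F k has_real_derivative a x i k) (at x)" if "k < n" "1/2 < x" "x < 4" for k x
      using integral_has_real_derivative[OF cont[OF ij(1) that(1)], of x] that
        at_within_interior[of x "{1/2..4}"] by (simp add: interior_atLeastAtMost_real)
    have F2: "((\<lambda>x. ?F k (x * 2)) has_real_derivative a (1 * 2) i k * 2) (at 1)" if "k < n" for k
      using that by (intro DERIV_chain2[OF F]) (auto intro!: derivative_eq_intros)
    have inv: "((\<lambda>x::real. 1 / x) has_real_derivative - 1) (at 1)"
      by (auto intro!: derivative_eq_intros)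
    have Dk: "((\<lambda>x. (1 / x) * (?F k (x * 2) - ?F k x) * Q' k j) has_real_derivative
        (- 1 * (?F k (1 * 2) - ?F k 1) + (a (1 * 2) i k * 2 - a 1 i k) * (1 / 1)) * Q' k j) (at 1)" if "k < n" for k
      by (intro DERIV_cmult_right DERIV_mult[OF inv] DERIV_diff F2[OF that] F[OF that]) auto
    have D: "((\<lambda>x. \<Sum>k<n. (1 / x) * (?F k (x * 2) - ?F k x) * Q' k j) has_real_derivative
        (\<Sum>k<n. (- 1 * (?F k (1 * 2) - ?F k 1) + (a (1 * 2) i k * 2 - a 1 i k) * (1 / 1)) * Q' k j)) (at 1)"
      by (intro DERIV_sum Dk) simp
    have ev: "\<forall>\<^sub>F x in nhds 1. (\<Sum>k<n. (1 / x) * (?F k (x * 2) - ?F k x) * Q' k j) = a x i j"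
    proof (rule eventually_mono[OF eventually_nhds_in_open[of "{1/2::real<..<2}"]])
      fix x :: real assume x: "x \<in> {1/2<..<2}"
      have "?F k (x * 2) - ?F k x = integral {x..x * 2} (\<lambda>y. a y i k)" if "k < n" for k
        using integral_combine[of "1/2" x "x * 2" "\<lambda>y. a y i k"] int[OF ij(1) that] x by auto
      then show "(\<Sum>k<n. (1 / x) * (?F k (x * 2) - ?F k x) * Q' k j) = a x i j"
        using Q'[of x i j] ij x by simp
    qed auto
    show ?thesis by (rule exI, rule iffD1[OF DERIV_cong_ev[OF refl ev refl] D])
  qed
  then show ?thesis using that by metis
qed

end

section \<open>Matrix powers and the exponential series\<close>

lemma abs_pow_mat_index_le:
  fixes B :: "real mat"
  assumes B: "B \<in> carrier_mat n n" and c: "\<And>i j. i < n \<Longrightarrow> j < n \<Longrightarrow> \<bar>B $$ (i, j)\<bar> \<le> c" "c \<ge> 0"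
  shows "i < n \<Longrightarrow> j < n \<Longrightarrow> \<bar>(B ^\<^sub>m k) $$ (i, j)\<bar> \<le> (real n * c) ^ k"
proof (induction k arbitrary: j)
  case (Suc k)
  have "(B ^\<^sub>m Suc k) $$ (i, j) = (\<Sum>l<n. (B ^\<^sub>m k) $$ (i, l) * B $$ (l, j))"
    using mult_mat_index_sum[of "B ^\<^sub>m k" n B i j] B Suc.prems by simp
  then have "\<bar>(B ^\<^sub>m Suc k) $$ (i, j)\<bar> \<le> (\<Sum>l<n. \<bar>(B ^\<^sub>m k) $$ (i, l) * B $$ (l, j)\<bar>)"
    by (simp only: sum_abs)
  also have "\<dots> \<le> (\<Sum>l<n. (real n * c) ^ k * c)"
    using Suc c by (intro sum_mono) (auto simp: abs_mult intro!: mult_mono)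
  also have "\<dots> = (real n * c) ^ Suc k" by simp
  finally show ?case .
qed (use B in auto)

lemma upper_triangular_pow_index:
  fixes B :: "'a :: comm_semiring_1 mat"
  assumes B: "B \<in> carrier_mat n n" "upper_triangular B" and "i < n"
  shows "j < i \<Longrightarrow> (B ^\<^sub>m k) $$ (i, j) = 0" "(B ^\<^sub>m k) $$ (i, i) = (B $$ (i, i)) ^ k"
proof -
  have "(\<forall>j<i. (B ^\<^sub>m k) $$ (i, j) = 0) \<and> (B ^\<^sub>m k) $$ (i, i) = (B $$ (i, i)) ^ k"
  proof (induction k)
    case (Suc k)
    have eq: "(B ^\<^sub>m Suc k) $$ (i, j) = (\<Sum>l<n. (B ^\<^sub>m k) $$ (i, l) * B $$ (l, j))" if "j < n" for j
      using mult_mat_index_sum[of "B ^\<^sub>m k" n B i j] B \<open>i < n\<close> that by simp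
    have z: "(B ^\<^sub>m k) $$ (i, l) * B $$ (l, j) = 0" if "l < n" "j \<le> i" "l \<noteq> i \<or> j \<noteq> i" for l j
    proof (cases "l < i")
      case True
      then show ?thesis using Suc by simp
    next
      case False
      then have "j < l" using that by auto
      then have "B $$ (l, j) = 0" using B that by auto
      then show ?thesis by simp
    qed
    have "(\<Sum>l<n. (B ^\<^sub>m k) $$ (i, l) * B $$ (l, i)) = (\<Sum>l\<in>{i}. (B ^\<^sub>m k) $$ (i, l) * B $$ (l, i))"
      using z \<open>i < n\<close> by (intro sum.mono_neutral_right) auto
    then have "(B ^\<^sub>m Suc k) $$ (i, i) = (B $$ (i, i)) ^ Suc k"
      using eq[OF \<open>i < n\<close>] Suc by (simp add: mult.commute)
    moreover have "(B ^\<^sub>m Suc k) $$ (i, j) = 0" if "j < i" for j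
      using eq[of j] z[of _ j] that \<open>i < n\<close> by simp
    ultimately show ?case by blast
  qed (use B \<open>i < n\<close> in auto)
  then show "j < i \<Longrightarrow> (B ^\<^sub>m k) $$ (i, j) = 0" "(B ^\<^sub>m k) $$ (i, i) = (B $$ (i, i)) ^ k" by auto
qed

context triangular_hom
begin

text \<open>With s = ln x the homomorphism solves f' = B f, where B is the derivative at 1, so its
  Taylor coefficients at 0 are the powers of B over factorials. The result is kept as a series so
  that diagonal entries and left eigenvectors can be read off term by term.\<close>

lemma hom_exp_series:
  obtains B where "B \<in> carrier_mat n n" "upper_triangular B"
    "\<And>x i j. \<lbrakk>x > 0; i < n; j < n\<rbrakk> \<Longrightarrow> (\<lambda>k. (B ^\<^sub>m k) $$ (i, j) / fact k * ln x ^ k) sums a x i j"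
proof -
  obtain b where b: "\<And>i j. i < n \<Longrightarrow> j < n \<Longrightarrow> ((\<lambda>x. a x i j) has_real_derivative b i j) (at 1)"
    using hom_differentiable_one by blast
  define B where "B = Matrix.mat n n (\<lambda>(i, j). b i j)"
  have B: "B \<in> carrier_mat n n" by (simp add: B_def)
  have "b i j = 0" if "i < n" "j < i" for i j
  proof -
    have "((\<lambda>x. a x i j) has_real_derivative 0) (at 1) \<longleftrightarrow> ((\<lambda>x. 0::real) has_real_derivative 0) (at (1::real))"
    proof (rule DERIV_cong_ev)
      show "\<forall>\<^sub>F x in nhds 1. a x i j = 0"
        by (rule eventually_mono[OF eventually_nhds_in_open[of "{0::real<..}"]])
           (use that hom_tri in auto)
    qed auto
    then have "((\<lambda>x. a x i j) has_real_derivative 0) (at 1)" by simp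
    then show ?thesis using b[of i j] that DERIV_unique by auto
  qed
  then have tri: "upper_triangular B" by (auto simp: B_def)
  define f where "f s = a (exp s)" for s
  have deriv: "((\<lambda>s. f s i j) has_real_derivative (\<Sum>k<n. b i k * f s k j)) (at s)"
    if ij: "i < n" "j < n" for i j s
  proof -
    have "((\<lambda>s'. a (exp (s' - s)) i k) has_real_derivative b i k * 1) (at s)" if k: "k < n" for k
    proof (rule DERIV_chain2[where f = "\<lambda>x. a x i k"])
      show "((\<lambda>x. a x i k) has_real_derivative b i k) (at (exp (s - s)))"
        using b[OF ij(1) k] by simp
      show "((\<lambda>s'. exp (s' - s)) has_real_derivative 1) (at s)"
        by (auto intro!: derivative_eq_intros)
    qed
    then have "((\<lambda>s'. \<Sum>k<n. a (exp (s' - s)) i k * f s k j) has_real_derivative (\<Sum>k<n. b i k * 1 * f s k j)) (at s)"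
      by (intro DERIV_sum DERIV_cmult_right) auto
    moreover have "(\<Sum>k<n. a (exp (s' - s)) i k * f s k j) = f s' i j" for s'
      using hom_mult[of "exp (s' - s)" "exp s" i j] ij by (simp add: f_def flip: exp_add)
    ultimately show ?thesis by simp
  qed
  have f0: "f 0 i j = (if i = j then 1 else 0)" if "i < n" "j < n" for i j
    using hom_one[OF that] by (simp add: f_def)
  have fsums: "(\<lambda>k. (B ^\<^sub>m k) $$ (i, j) / fact k * s ^ k) sums f s i j" if ij: "i < n" "j < n" for i j s
  proof -
    \<comment> \<open>\<open>d m\<close> is the \<open>m\<close>-th derivative of the entry: the (i,
      j) entry of B^m f(s).\<close>
    define d where "d m s = (\<Sum>k<n. (B ^\<^sub>m m) $$ (i, k) * f s k j)" for m s
    have d0: "d 0 = (\<lambda>s. f s i j)"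
    proof
      fix s
      have "d 0 s = (\<Sum>k<n. if i = k then f s k j else 0)"
        unfolding d_def using B ij by (intro sum.cong) auto
      then show "d 0 s = f s i j" using ij by simp
    qed
    have dS: "DERIV (d m) s :> d (Suc m) s" for m s
    proof -
      have "DERIV (d m) s :> (\<Sum>k<n. (B ^\<^sub>m m) $$ (i, k) * (\<Sum>l<n. b k l * f s l j))"
        unfolding d_def using ij by (intro DERIV_sum DERIV_cmult deriv) auto
      also have "(\<Sum>k<n. (B ^\<^sub>m m) $$ (i, k) * (\<Sum>l<n. b k l * f s l j))
          = (\<Sum>l<n. \<Sum>k<n. (B ^\<^sub>m m) $$ (i, k) * b k l * f s l j)"
        unfolding sum_distrib_left mult.assoc by (rule sum.swap)
      also have "\<dots> = d (Suc m) s"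
        unfolding d_def
      proof (intro sum.cong refl)
        fix l assume l: "l \<in> {..<n}"
        have "(B ^\<^sub>m Suc m) $$ (i, l) = (\<Sum>k<n. (B ^\<^sub>m m) $$ (i, k) * B $$ (k, l))"
          using mult_mat_index_sum[of "B ^\<^sub>m m" n B i l] B ij l by simp
        also have "\<dots> = (\<Sum>k<n. (B ^\<^sub>m m) $$ (i, k) * b k l)"
          using l by (intro sum.cong) (auto simp: B_def)
        finally show "(\<Sum>k<n. (B ^\<^sub>m m) $$ (i, k) * b k l * f s l j) = (B ^\<^sub>m Suc m) $$ (i, l) * f s l j"
          by (simp only: sum_distrib_right)
      qed
      finally show ?thesis .
    qed
    have dz: "d m 0 = (B ^\<^sub>m m) $$ (i, j)" for m
    proof -
      have "d m 0 = (\<Sum>k<n. if k = j then (B ^\<^sub>m m) $$ (i, k) else 0)"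
        unfolding d_def using f0 ij by (intro sum.cong) auto
      then show ?thesis using ij by simp
    qed
    have "continuous_on {-\<bar>s\<bar>..\<bar>s\<bar>} (\<lambda>t. \<Sum>k<n. \<bar>f t k j\<bar>)"
      using deriv ij
      by (intro continuous_intros continuous_at_imp_continuous_on ballI) (auto intro: DERIV_isCont)
    then have "bounded ((\<lambda>t. \<Sum>k<n. \<bar>f t k j\<bar>) ` {-\<bar>s\<bar>..\<bar>s\<bar>})"
      by (intro compact_imp_bounded compact_continuous_image) auto
    then obtain W where W: "\<And>t. \<bar>t\<bar> \<le> \<bar>s\<bar> \<Longrightarrow> \<bar>\<Sum>k<n. \<bar>f t k j\<bar>\<bar> \<le> W"
    proof -
      obtain W where "\<forall>y\<in>(\<lambda>t. \<Sum>k<n. \<bar>f t k j\<bar>) ` {-\<bar>s\<bar>..\<bar>s\<bar>}. norm y \<le> W"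
        using \<open>bounded _\<close> unfolding bounded_iff by blast
      then show ?thesis using that[of W] by (simp add: abs_le_iff)
    qed
    define c where "c = (\<Sum>i<n. \<Sum>j<n. \<bar>B $$ (i, j)\<bar>)"
    have c0: "c \<ge> 0" unfolding c_def by (intro sum_nonneg) auto
    have "\<bar>B $$ (k, l)\<bar> \<le> c" if "k < n" "l < n" for k l
    proof -
      have "\<bar>B $$ (k, l)\<bar> \<le> (\<Sum>j<n. \<bar>B $$ (k, j)\<bar>)"
        by (rule member_le_sum) (use that in auto)
      also have "\<dots> \<le> c" unfolding c_def
        by (rule member_le_sum[of k _ "\<lambda>i. \<Sum>j<n. \<bar>B $$ (i, j)\<bar>"])
           (use that in \<open>auto intro: sum_nonneg\<close>)
      finally show ?thesis .
    qed
    note pow_le = abs_pow_mat_index_le[OF B this c0]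
    define \<beta> where "\<beta> = real n * c"
    have dle: "\<bar>d m t\<bar> \<le> \<beta> ^ m * W" if t: "\<bar>t\<bar> \<le> \<bar>s\<bar>" for m t
    proof -
      have "\<bar>d m t\<bar> \<le> (\<Sum>k<n. \<bar>(B ^\<^sub>m m) $$ (i, k) * f t k j\<bar>)"
        unfolding d_def by (rule sum_abs)
      also have "\<dots> \<le> (\<Sum>k<n. \<beta> ^ m * \<bar>f t k j\<bar>)"
        using pow_le ij unfolding \<beta>_def by (intro sum_mono) (auto simp: abs_mult intro!: mult_right_mono)
      also have "\<dots> = \<beta> ^ m * (\<Sum>k<n. \<bar>f t k j\<bar>)" by (simp add: sum_distrib_left)
      also have "\<dots> \<le> \<beta> ^ m * W"
        using W[OF t] c0 by (intro mult_left_mono) (auto simp: \<beta>_def)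
      finally show ?thesis .
    qed
    \<comment> \<open>Lagrange remainder of the Taylor expansion; the bound is \<open>W\<close>
      times the general term of an exponential series, which tends to zero.\<close>
    have rem: "norm ((\<Sum>m<N. (B ^\<^sub>m m) $$ (i, j) / fact m * s ^ m) - f s i j) \<le> W * (inverse (fact N) * (\<beta> * \<bar>s\<bar>) ^ N)" for N
    proof -
      obtain t where t: "\<bar>t\<bar> \<le> \<bar>s\<bar>"
        "f s i j = (\<Sum>m<N. d m 0 / fact m * s ^ m) + d N t / fact N * s ^ N"
        using Maclaurin_all_le[of d "\<lambda>s. f s i j" s N] d0 dS by blast
      have "norm ((\<Sum>m<N. (B ^\<^sub>m m) $$ (i, j) / fact m * s ^ m) - f s i j) = \<bar>d N t / fact N * s ^ N\<bar>"
        using t(2) by (simp add: dz)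
      also have "\<dots> = \<bar>d N t\<bar> * (\<bar>s\<bar> ^ N / fact N)" by (simp add: abs_mult power_abs)
      also have "\<dots> \<le> (\<beta> ^ N * W) * (\<bar>s\<bar> ^ N / fact N)"
        by (intro mult_right_mono dle t) auto
      finally show ?thesis by (simp add: power_mult_distrib divide_inverse mult_ac)
    qed
    have "(\<lambda>N. W * (inverse (fact N) * (\<beta> * \<bar>s\<bar>) ^ N)) \<longlonglongrightarrow> W * 0"
      by (intro tendsto_mult tendsto_const summable_LIMSEQ_zero summable_exp)
    then have "(\<lambda>N. W * (inverse (fact N) * (\<beta> * \<bar>s\<bar>) ^ N)) \<longlonglongrightarrow> 0" by simp
    then have "(\<lambda>N. (\<Sum>m<N. (B ^\<^sub>m m) $$ (i, j) / fact m * s ^ m) - f s i j) \<longlonglongrightarrow> 0"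
      by (rule Lim_null_comparison[rotated]) (use rem in auto)
    then show ?thesis unfolding sums_def by (simp add: LIM_zero_iff)
  qed
  show ?thesis
  proof (rule that[OF B tri])
    fix x :: real and i j assume "x > 0" "i < n" "j < n"
    then show "(\<lambda>k. (B ^\<^sub>m k) $$ (i, j) / fact k * ln x ^ k) sums a x i j"
      using fsums[of i j "ln x"] by (simp add: f_def)
  qed
qed

end

lemma mat_powr_index_sums:
  assumes B: "B \<in> carrier_mat n n" and "i < n" "j < n"
    and "(\<lambda>k. (B ^\<^sub>m k) $$ (i, j) / fact k * ln x ^ k) sums l"
  shows "mat_powr x B $$ (i, j) = l"
proof -
  have "mat_powr x B $$ (i, j) = (\<Sum>k. (B ^\<^sub>m k) $$ (i, j) / fact k * ln x ^ k)"
    using assms(1-3) by (simp add: mat_powr_def mat_exp_def pow_smult_mat_index[OF B] mult.commute)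
  then show ?thesis using assms(4) by (simp add: sums_iff)
qed

lemma exp_series_sums_powr:
  fixes x b :: real
  assumes "x > 0"
  shows "(\<lambda>k. b ^ k / fact k * ln x ^ k) sums (x powr b)"
  using exp_converges[of "b * ln x"] assms
  by (simp add: powr_def power_mult_distrib divide_inverse mult_ac scaleR_conv_of_real)

section \<open>Left eigenvectors and kernel dimension\<close>

lemma left_eigenvector_pow:
  fixes B :: "'a :: comm_ring_1 mat"
  assumes B: "B \<in> carrier_mat n n"
    and v: "\<And>j. j < n \<Longrightarrow> (\<Sum>i<n. v i * B $$ (i, j)) = b * v j"
  shows "j < n \<Longrightarrow> (\<Sum>i<n. v i * (B ^\<^sub>m k) $$ (i, j)) = b ^ k * v j"
proof (induction k arbitrary: j)
  case 0
  have "(\<Sum>i<n. v i * (B ^\<^sub>m 0) $$ (i, j)) = (\<Sum>i<n. if i = j then v i else 0)"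
    using B 0 by (intro sum.cong) auto
  then show ?case using 0 by simp
next
  case (Suc k)
  have "(\<Sum>i<n. v i * (B ^\<^sub>m Suc k) $$ (i, j)) = (\<Sum>i<n. \<Sum>l<n. v i * (B ^\<^sub>m k) $$ (i, l) * B $$ (l, j))"
    using mult_mat_index_sum[of "B ^\<^sub>m k" n B _ j] B Suc.prems
    by (intro sum.cong) (auto simp: sum_distrib_left mult.assoc)
  also have "\<dots> = (\<Sum>l<n. (\<Sum>i<n. v i * (B ^\<^sub>m k) $$ (i, l)) * B $$ (l, j))"
    unfolding sum_distrib_right by (rule sum.swap)
  also have "\<dots> = (\<Sum>l<n. b ^ k * (v l * B $$ (l, j)))"
    using Suc.IH by (intro sum.cong) (auto simp: mult.assoc)
  also have "\<dots> = b ^ k * (b * v j)"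
    using v[OF Suc.prems] by (simp flip: sum_distrib_left)
  finally show ?case by simp
qed

text \<open>Passes from left to right kernel: with the reduced form E = P M, the kernel dimension is
  the number of zero rows of E, and the rows of the invertible P at those positions lie in the left
  kernel. Two such rows would be independent against \<open>dep\<close>; none at all would make E
  the identity and M nonsingular.\<close>

lemma kernel_dim_eq_one:
  fixes M :: "'a :: field mat"
  assumes M: "M \<in> carrier_mat n n" and det: "det M = 0"
    and dep: "\<And>v w. \<lbrakk>\<And>j. j < n \<Longrightarrow> (\<Sum>i<n. v i * M $$ (i, j)) = 0; \<And>j. j < n \<Longrightarrow> (\<Sum>i<n. w i * M $$ (i, j)) = 0\<rbrakk>
      \<Longrightarrow> \<exists>p q. (p \<noteq> 0 \<or> q \<noteq> 0) \<and> (\<forall>i<n. p * v i + q * w i = 0)"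
  shows "kernel_dim M = 1"
proof -
  define E where "E = gauss_jordan_single M"
  note gj = gauss_jordan_single[OF M E_def[symmetric]]
  obtain P Q where PQ: "E = P * M" "P \<in> carrier_mat n n" "Q \<in> carrier_mat n n" "P * Q = 1\<^sub>m n" "Q * P = 1\<^sub>m n"
    using gj(4) by blast
  define Z where "Z = {i. i < n \<and> row E i = 0\<^sub>v n}"
  have finZ: "finite Z" by (simp add: Z_def)
  have "kernel_dim M = n - card {i. i < n \<and> row E i \<noteq> 0\<^sub>v n}"
    using kernel_dim_code[of M] find_base_vectors(5)[OF gj(3,2)] M by (simp add: E_def)
  also have "{i. i < n \<and> row E i \<noteq> 0\<^sub>v n} = {..<n} - Z" by (auto simp: Z_def)
  also have "n - card ({..<n} - Z) = card Z"
  proof -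
    have "Z \<subseteq> {..<n}" by (auto simp: Z_def)
    then show ?thesis using card_mono[of "{..<n}" Z] by (simp add: card_Diff_subset finZ)
  qed
  finally have kd: "kernel_dim M = card Z" .
  have left_ker: "(\<Sum>i<n. P $$ (k, i) * M $$ (i, j)) = 0" if "k \<in> Z" "j < n" for k j
  proof -
    have k: "k < n" and zero: "row E k = 0\<^sub>v n" using that(1) by (auto simp: Z_def)
    have "(\<Sum>i<n. P $$ (k, i) * M $$ (i, j)) = E $$ (k, j)"
      using mult_mat_index_sum[OF PQ(2) M k that(2)] by (simp add: PQ(1))
    also have "\<dots> = row E k $ j" using k that(2) gj(2) by simp
    finally show ?thesis using that(2) by (simp add: zero)
  qed
  have "\<not> (\<exists>k\<in>Z. \<exists>l\<in>Z. k \<noteq> l)"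
  proof
    assume "\<exists>k\<in>Z. \<exists>l\<in>Z. k \<noteq> l"
    then obtain k l where kl: "k \<in> Z" "l \<in> Z" "k \<noteq> l" by blast
    then have kln: "k < n" "l < n" by (auto simp: Z_def)
    obtain p q where pq: "p \<noteq> 0 \<or> q \<noteq> 0" "\<And>i. i < n \<Longrightarrow> p * P $$ (k, i) + q * P $$ (l, i) = 0"
      using dep[of "\<lambda>i. P $$ (k, i)" "\<lambda>i. P $$ (l, i)"] left_ker kl by blast
    \<comment> \<open>Multiplying the dependence between two rows of \<open>P\<close> by its inverse
      \<open>Q\<close> turns it into a dependence between two distinct unit vectors.\<close>
    have "p * (1\<^sub>m n :: 'a mat) $$ (k, m) + q * (1\<^sub>m n :: 'a mat) $$ (l, m) = 0" if m: "m < n" for m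
    proof -
      have "p * (P * Q) $$ (k, m) + q * (P * Q) $$ (l, m)
          = (\<Sum>i<n. (p * P $$ (k, i) + q * P $$ (l, i)) * Q $$ (i, m))"
        unfolding mult_mat_index_sum[OF PQ(2,3) kln(1) m] mult_mat_index_sum[OF PQ(2,3) kln(2) m]
        by (simp add: sum_distrib_left sum.distrib algebra_simps)
      also have "\<dots> = 0" using pq(2) by simp
      finally show ?thesis by (simp only: PQ(4))
    qed
    from this[OF kln(1)] this[OF kln(2)] show False using kln kl(3) pq(1) by simp
  qed
  then have "card Z \<le> 1" using finZ by (auto simp: card_le_Suc0_iff_eq)
  moreover have "Z \<noteq> {}"
  proof
    assume "Z = {}"
    then have "E = 1\<^sub>m n"
      using row_echelon_form_imp_1_or_0_row[OF gj(2,3)] by (auto simp: Z_def)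
    then have "det P * det M = 1" using det_mult[OF PQ(2) M] PQ(1) by simp
    then show False using det by simp
  qed
  then have "card Z \<noteq> 0" using finZ by simp
  ultimately show ?thesis using kd by simp
qed

section \<open>Indices and left eigenvectors\<close>

lemma filterlim_pow_mult_at_top:
  assumes "T > 0"
  shows "filterlim (\<lambda>k. 2 ^ k * T :: real) at_top sequentially"
proof -
  have "filterlim (\<lambda>k. 2 ^ k :: real) at_top sequentially"
    by (rule filterlim_at_top_mono[OF filterlim_real_sequentially])
       (simp add: of_nat_less_two_power less_imp_le)
  then show ?thesis
    using assms by (intro filterlim_at_top_mult_tendsto_pos[OF tendsto_const]) (auto simp: mult.commute)
qed

text \<open>
  A function that is almost homogeneous of degree \<open>b\<close> is asymptotically a multiple of \<open>t\<^sup>b\<close>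
  when the remainder scale \<open>G\<close> has a smaller index. Along \<open>2\<^sup>k t\<close> the increments of
  \<open>\<phi>(t) = f(t) / t\<^sup>b\<close> are dominated by those of a multiple of \<open>\<psi>(t) = |G(t)| / t\<^sup>b\<close>, so they
  telescope; no uniformity in the dilation is needed.
\<close>
lemma almost_homogeneous_asymptotics:
  fixes f G :: "real \<Rightarrow> real"
  assumes f: "\<And>x. x > 0 \<Longrightarrow> (\<lambda>t. f (x * t) - x powr b * f t) \<in> o[at_top](G)"
    and G2: "((\<lambda>t. G (2 * t) / G t) \<longlongrightarrow> 2 powr \<gamma>) at_top" and less: "\<gamma> < b"
    and nz: "\<forall>\<^sub>F t in at_top. G t \<noteq> 0"
  obtains c where "(\<lambda>t. f t - c * t powr b) \<in> o[at_top](G)"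
proof -
  define \<phi> where "\<phi> t = f t / t powr b" for t
  define \<psi> where "\<psi> t = \<bar>G t\<bar> / t powr b" for t
  \<comment> \<open>The quotient \<psi>(2t)/\<psi>(t) tends to 2^(\<gamma> - b) < 1; halving the
    exponent gives a ratio strictly between this limit and 1.\<close>
  define \<rho> :: real where "\<rho> = 2 powr ((\<gamma> - b) / 2)"
  have \<rho>: "0 < \<rho>" "\<rho> < 1" using less by (auto simp: \<rho>_def powr_less_one)
  have "2 powr \<gamma> < \<rho> * 2 powr b"
  proof -
    have "\<rho> * 2 powr b = 2 powr ((\<gamma> - b) / 2 + b)" by (simp add: \<rho>_def powr_add)
    moreover have "\<gamma> < (\<gamma> - b) / 2 + b" using less by (simp add: field_simps)
    ultimately show ?thesis by simp
  qed
  moreover have "((\<lambda>t. \<bar>G (2 * t) / G t\<bar>) \<longlongrightarrow> \<bar>2 powr \<gamma>\<bar>) at_top" by (intro tendsto_rabs G2)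
  ultimately have "\<forall>\<^sub>F t in at_top. \<bar>G (2 * t) / G t\<bar> < \<rho> * 2 powr b"
    by (intro order_tendstoD(2)) auto
  then have "\<forall>\<^sub>F t in at_top. 0 < t \<and> G t \<noteq> 0 \<and> \<psi> (2 * t) \<le> \<rho> * \<psi> t"
    using eventually_gt_at_top[of 0] nz
  proof eventually_elim
    case (elim t)
    then have "\<bar>G (2 * t)\<bar> \<le> \<rho> * 2 powr b * \<bar>G t\<bar>"
      by (simp add: abs_divide pos_divide_less_eq less_imp_le)
    then have "\<psi> (2 * t) \<le> (\<rho> * 2 powr b * \<bar>G t\<bar>) / (2 * t) powr b"
      unfolding \<psi>_def by (intro divide_right_mono) auto
    also have "\<dots> = \<rho> * \<psi> t" using elim by (simp add: \<psi>_def powr_mult)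
    finally show ?case using elim by simp
  qed
  then obtain T0 where T0: "\<And>t. t \<ge> T0 \<Longrightarrow> 0 < t \<and> G t \<noteq> 0 \<and> \<psi> (2 * t) \<le> \<rho> * \<psi> t"
    unfolding eventually_at_top_linorder by blast
  have T0pos: "T0 > 0" using T0[of T0] by simp
  have pow_ge: "t \<le> 2 ^ k * t" if "t \<ge> T0" for t :: real and k
    using mult_right_mono[of 1 "2 ^ k" t] that T0pos by simp
  have \<psi>_pos: "\<psi> t > 0" if "t \<ge> T0" for t using T0[OF that] by (simp add: \<psi>_def)
  have \<psi>_pow: "\<psi> (2 ^ k * t) \<le> \<rho> ^ k * \<psi> t" if "t \<ge> T0" for t k
  proof (induction k)
    case (Suc k)
    have "\<psi> (2 * (2 ^ k * t)) \<le> \<rho> * \<psi> (2 ^ k * t)"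
      using T0[of "2 ^ k * t"] pow_ge[OF that, of k] that by auto
    also have "\<dots> \<le> \<rho> * (\<rho> ^ k * \<psi> t)" using Suc \<rho> by (intro mult_left_mono) auto
    finally show ?case by (simp add: mult.assoc)
  qed simp
  have \<psi>_lim: "(\<lambda>k. \<psi> (2 ^ k * t)) \<longlonglongrightarrow> 0" if "t \<ge> T0" for t
  proof (rule tendsto_sandwich[where f = "\<lambda>_. 0" and h = "\<lambda>k. \<rho> ^ k * \<psi> t"])
    show "(\<lambda>k. \<rho> ^ k * \<psi> t) \<longlonglongrightarrow> 0"
      using \<rho> by (intro tendsto_mult_left_zero LIMSEQ_realpow_zero) auto
    show "\<forall>\<^sub>F k in sequentially. 0 \<le> \<psi> (2 ^ k * t)" by (simp add: \<psi>_def)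
    show "\<forall>\<^sub>F k in sequentially. \<psi> (2 ^ k * t) \<le> \<rho> ^ k * \<psi> t" using \<psi>_pow[OF that] by simp
  qed simp
  \<comment> \<open>The factor 1 - \<rho> in the tolerance is chosen because (1 - \<rho>) \<psi>(t)
    <= \<psi>(t) - \<psi>(2t); bounding by a decrement of \<psi> makes the right side telescope
    too.\<close>
  have incr: "\<exists>T\<ge>T0. \<forall>t\<ge>T. \<bar>\<phi> (2 * t) - \<phi> t\<bar> \<le> \<delta> * (\<psi> t - \<psi> (2 * t))" if \<delta>: "\<delta> > 0" for \<delta>
  proof -
    have "\<forall>\<^sub>F t in at_top. norm (f (2 * t) - 2 powr b * f t) \<le> (\<delta> * (1 - \<rho>) * 2 powr b) * norm (G t)"
      using \<delta> \<rho> by (intro landau_o.smallD[OF f]) auto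
    then obtain T1 where T1: "\<And>t. t \<ge> T1 \<Longrightarrow> \<bar>f (2 * t) - 2 powr b * f t\<bar> \<le> (\<delta> * (1 - \<rho>) * 2 powr b) * \<bar>G t\<bar>"
      unfolding eventually_at_top_linorder by auto
    have "\<bar>\<phi> (2 * t) - \<phi> t\<bar> \<le> \<delta> * (\<psi> t - \<psi> (2 * t))" if "t \<ge> max T0 T1" for t
    proof -
      have t: "t > 0" "\<psi> (2 * t) \<le> \<rho> * \<psi> t" using T0[of t] that by auto
      have "\<phi> (2 * t) - \<phi> t = (f (2 * t) - 2 powr b * f t) / (2 * t) powr b"
        using t by (simp add: \<phi>_def powr_mult field_simps)
      then have "\<bar>\<phi> (2 * t) - \<phi> t\<bar> = \<bar>f (2 * t) - 2 powr b * f t\<bar> / (2 * t) powr b"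
        by (simp add: abs_divide)
      also have "\<dots> \<le> ((\<delta> * (1 - \<rho>) * 2 powr b) * \<bar>G t\<bar>) / (2 * t) powr b"
        using T1[of t] that by (intro divide_right_mono) auto
      also have "\<dots> = \<delta> * (\<psi> t - \<rho> * \<psi> t)" using t by (simp add: \<psi>_def powr_mult field_simps)
      also have "\<dots> \<le> \<delta> * (\<psi> t - \<psi> (2 * t))" using t \<delta> by (intro mult_left_mono) auto
      finally show ?thesis .
    qed
    then show ?thesis by (intro exI[of _ "max T0 T1"]) auto
  qed
  have tele: "\<exists>T\<ge>T0. \<forall>t\<ge>T. \<forall>k. \<bar>\<phi> (2 ^ k * t) - \<phi> t\<bar> \<le> \<delta> * (\<psi> t - \<psi> (2 ^ k * t))" if \<delta>: "\<delta> > 0" for \<delta>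
  proof -
    obtain T where T: "T \<ge> T0" "\<And>t. t \<ge> T \<Longrightarrow> \<bar>\<phi> (2 * t) - \<phi> t\<bar> \<le> \<delta> * (\<psi> t - \<psi> (2 * t))"
      using incr[OF \<delta>] by blast
    have "\<bar>\<phi> (2 ^ k * t) - \<phi> t\<bar> \<le> \<delta> * (\<psi> t - \<psi> (2 ^ k * t))" if "t \<ge> T" for t k
    proof (induction k)
      case (Suc k)
      have "2 ^ k * t \<ge> T" using pow_ge[of t k] that T(1) by simp
      then have "\<bar>\<phi> (2 * (2 ^ k * t)) - \<phi> (2 ^ k * t)\<bar> \<le> \<delta> * (\<psi> (2 ^ k * t) - \<psi> (2 * (2 ^ k * t)))"
        by (rule T(2))
      then have "\<bar>\<phi> (2 * (2 ^ k * t)) - \<phi> t\<bar> \<le> \<delta> * (\<psi> t - \<psi> (2 * (2 ^ k * t)))"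
        using Suc by (simp add: right_diff_distrib)
      then show ?case by (simp add: mult.assoc)
    qed simp
    then show ?thesis using T(1) by blast
  qed
  obtain T where T: "T \<ge> T0" "\<And>t k. t \<ge> T \<Longrightarrow> \<bar>\<phi> (2 ^ k * t) - \<phi> t\<bar> \<le> 1 * (\<psi> t - \<psi> (2 ^ k * t))"
    using tele[of 1] by auto
  have conv: "convergent (\<lambda>k. \<phi> (2 ^ k * t))" if t: "t \<ge> T" for t
  proof -
    have "summable (\<lambda>k. \<phi> (2 ^ Suc k * t) - \<phi> (2 ^ k * t))"
    proof (rule summable_comparison_test')
      show "summable (\<lambda>k. \<rho> ^ k * \<psi> t)" using \<rho> by (intro summable_mult2 summable_geometric) auto
      fix k :: nat
      have tT: "2 ^ k * t \<ge> T" using pow_ge[of t k] t T(1) by simp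
      have "\<bar>\<phi> (2 ^ 1 * (2 ^ k * t)) - \<phi> (2 ^ k * t)\<bar> \<le> 1 * (\<psi> (2 ^ k * t) - \<psi> (2 ^ 1 * (2 ^ k * t)))"
        by (rule T(2)[OF tT])
      also have "\<dots> \<le> \<psi> (2 ^ k * t)" by (simp add: \<psi>_def)
      also have "\<dots> \<le> \<rho> ^ k * \<psi> t" using t T(1) by (intro \<psi>_pow) auto
      finally show "norm (\<phi> (2 ^ Suc k * t) - \<phi> (2 ^ k * t)) \<le> \<rho> ^ k * \<psi> t" by (simp add: mult.assoc)
    qed
    then have "convergent (\<lambda>m. \<Sum>k<m. \<phi> (2 ^ Suc k * t) - \<phi> (2 ^ k * t))"
      by (simp only: summable_iff_convergent)
    moreover have "(\<Sum>k<m. \<phi> (2 ^ Suc k * t) - \<phi> (2 ^ k * t)) = \<phi> (2 ^ m * t) - \<phi> t" for m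
      using sum_lessThan_telescope[of "\<lambda>k. \<phi> (2 ^ k * t)" m] by simp
    ultimately show ?thesis by (simp only: convergent_diff_const_right_iff)
  qed
  define c where "c = lim (\<lambda>k. \<phi> (2 ^ k * T))"
  have c: "(\<lambda>k. \<phi> (2 ^ k * T)) \<longlonglongrightarrow> c"
    using conv[of T] by (simp add: c_def convergent_LIMSEQ_iff)
  \<comment> \<open>The limit does not depend on the starting point: the orbits of t and
    \<open>T\<close> differ by the fixed dilation x = t/T, so the hypothesis at this single x
    suffices, together with \<psi> tending to 0 along the orbit of \<open>T\<close>.\<close>
  have limc: "(\<lambda>k. \<phi> (2 ^ k * t)) \<longlonglongrightarrow> c" if t: "t \<ge> T" for t
  proof -
    define x where "x = t / T"
    have Tp: "T > 0" and x: "x > 0" using t T(1) T0pos by (auto simp: x_def)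
    have "((\<lambda>s. (f (x * s) - x powr b * f s) / G s) \<longlongrightarrow> 0) at_top"
      by (intro smalloD_tendsto f x)
    then have l1: "(\<lambda>k. (f (x * (2 ^ k * T)) - x powr b * f (2 ^ k * T)) / G (2 ^ k * T)) \<longlonglongrightarrow> 0"
      using filterlim_pow_mult_at_top[OF Tp] by (rule filterlim_compose)
    have "(\<lambda>k. \<bar>(f (x * (2 ^ k * T)) - x powr b * f (2 ^ k * T)) / G (2 ^ k * T)\<bar> * \<psi> (2 ^ k * T) / x powr b) \<longlonglongrightarrow> \<bar>0\<bar> * 0 / x powr b"
      using x by (intro tendsto_divide tendsto_mult tendsto_rabs l1 \<psi>_lim T(1) tendsto_const) auto
    moreover have "\<bar>(f (x * (2 ^ k * T)) - x powr b * f (2 ^ k * T)) / G (2 ^ k * T)\<bar> * \<psi> (2 ^ k * T) / x powr b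
        = \<bar>\<phi> (2 ^ k * t) - \<phi> (2 ^ k * T)\<bar>" for k
    proof -
      define s where "s = 2 ^ k * T"
      have s: "s > 0" "G s \<noteq> 0" using T0[of s] pow_ge[of T k] T(1) by (auto simp: s_def)
      have xs: "x * s = 2 ^ k * t" using Tp by (simp add: x_def s_def)
      have "\<phi> (x * s) - \<phi> s = (f (x * s) - x powr b * f s) / (x powr b * s powr b)"
        using s x by (simp add: \<phi>_def powr_mult field_simps)
      then have "\<bar>\<phi> (x * s) - \<phi> s\<bar> = \<bar>f (x * s) - x powr b * f s\<bar> / (x powr b * s powr b)"
        by (simp add: abs_divide abs_mult)
      also have "\<dots> = \<bar>(f (x * s) - x powr b * f s) / G s\<bar> * \<psi> s / x powr b"
        using s by (simp add: \<psi>_def abs_divide)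
      finally show ?thesis by (simp add: xs flip: s_def)
    qed
    ultimately have "(\<lambda>k. \<bar>\<phi> (2 ^ k * t) - \<phi> (2 ^ k * T)\<bar>) \<longlonglongrightarrow> 0" by simp
    then have "(\<lambda>k. \<phi> (2 ^ k * t) - \<phi> (2 ^ k * T)) \<longlonglongrightarrow> 0" by (simp only: tendsto_rabs_zero_iff)
    from tendsto_add[OF this c] show ?thesis by simp
  qed
  show ?thesis
  proof (rule that[of c], rule landau_o.smallI)
    fix \<delta> :: real assume \<delta>: "\<delta> > 0"
    obtain T' where T': "T' \<ge> T0" "\<And>t k. t \<ge> T' \<Longrightarrow> \<bar>\<phi> (2 ^ k * t) - \<phi> t\<bar> \<le> \<delta> * (\<psi> t - \<psi> (2 ^ k * t))"
      using tele[OF \<delta>] by blast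
    show "\<forall>\<^sub>F t in at_top. norm (f t - c * t powr b) \<le> \<delta> * norm (G t)"
      using eventually_ge_at_top[of "max T T'"]
    proof eventually_elim
      case (elim t)
      have t: "t > 0" using T0[of t] elim T'(1) by simp
      \<comment> \<open>Letting k grow in the telescoped bound gives |c - \<phi>(t)| <= \<delta>
        \<psi>(t), which is the claim divided by t^b.\<close>
      have "(\<lambda>k. \<bar>\<phi> (2 ^ k * t) - \<phi> t\<bar>) \<longlonglongrightarrow> \<bar>c - \<phi> t\<bar>"
        using elim by (intro tendsto_rabs tendsto_diff limc tendsto_const) auto
      moreover have "\<bar>\<phi> (2 ^ k * t) - \<phi> t\<bar> \<le> \<delta> * \<psi> t" for k
      proof -
        have "\<bar>\<phi> (2 ^ k * t) - \<phi> t\<bar> \<le> \<delta> * (\<psi> t - \<psi> (2 ^ k * t))" using elim by (intro T'(2)) auto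
        also have "\<dots> \<le> \<delta> * \<psi> t" using \<delta> by (intro mult_left_mono) (auto simp: \<psi>_def)
        finally show ?thesis .
      qed
      ultimately have le: "\<bar>c - \<phi> t\<bar> \<le> \<delta> * \<psi> t"
        by (intro LIMSEQ_le_const2[of _ "\<bar>c - \<phi> t\<bar>"]) auto
      have "f t - c * t powr b = - (c - \<phi> t) * t powr b" using t by (simp add: \<phi>_def field_simps)
      then have "norm (f t - c * t powr b) = \<bar>c - \<phi> t\<bar> * t powr b" by (simp add: abs_mult abs_minus_commute)
      also have "\<dots> \<le> \<delta> * \<psi> t * t powr b" by (intro mult_right_mono le) auto
      also have "\<dots> = \<delta> * norm (G t)" using t by (simp add: \<psi>_def)
      finally show ?case .
    qed
  qed
qed

context rates
begin

lemma scales_diag_limit: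
  assumes "scales x A" "x > 0" "i < n"
  shows "((\<lambda>t. g i (x * t) / g i t) \<longlongrightarrow> A i i) at_top"
  using scales_limit[OF assms(1,3,3)] scales_triangular[OF assms] by simp

text \<open>If \<beta>' > \<beta>, the ratio |g_(i+1)/g_i| is multiplied under doubling by a factor
  tending to 2^(\<beta>' - \<beta>) > 1. It is then nondecreasing along 2^k T, although it must tend
  to zero.\<close>

lemma index_le_Suc:
  assumes "scales 2 A" "Suc i < n" and "A i i = 2 powr \<beta>" "A (Suc i) (Suc i) = 2 powr \<beta>'"
  shows "\<beta>' \<le> \<beta>"
proof (rule ccontr)
  assume "\<not> \<beta>' \<le> \<beta>"
  then have less: "\<beta> < \<beta>'" by simp
  have i: "i < n" using assms(2) by simp
  define h where "h t = \<bar>g (Suc i) t / g i t\<bar>" for t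
  have "((\<lambda>t. \<bar>(g (Suc i) (2 * t) / g (Suc i) t) / (g i (2 * t) / g i t)\<bar>) \<longlongrightarrow> \<bar>2 powr \<beta>' / 2 powr \<beta>\<bar>) at_top"
    using scales_diag_limit[OF assms(1) _ assms(2)] scales_diag_limit[OF assms(1) _ i]
    by (intro tendsto_rabs tendsto_divide) (auto simp: assms)
  moreover have "1 < \<bar>2 powr \<beta>' / 2 powr \<beta> :: real\<bar>" using less by (simp add: abs_divide)
  ultimately have "\<forall>\<^sub>F t in at_top. 1 < \<bar>(g (Suc i) (2 * t) / g (Suc i) t) / (g i (2 * t) / g i t)\<bar>"
    by (rule order_tendstoD(1))
  then have "\<forall>\<^sub>F t in at_top. 0 < t \<and> 0 < h t \<and> h t \<le> h (2 * t)"
    using eventually_gt_at_top[of 0] ev_nonzero[OF i] ev_nonzero[OF assms(2)]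
  proof eventually_elim
    case (elim t)
    have "\<bar>(g (Suc i) (2 * t) / g (Suc i) t) / (g i (2 * t) / g i t)\<bar> = h (2 * t) / h t"
      by (simp add: h_def abs_divide abs_mult mult.commute)
    moreover have "h t > 0" using elim by (simp add: h_def)
    ultimately show ?case using elim by (simp add: less_divide_eq)
  qed
  then obtain T where T: "\<And>t. t \<ge> T \<Longrightarrow> 0 < t \<and> 0 < h t \<and> h t \<le> h (2 * t)"
    unfolding eventually_at_top_linorder by blast
  have Tp: "T > 0" "h T > 0" using T[of T] by auto
  have low: "h T \<le> h (2 ^ k * T)" for k
  proof (induction k)
    case (Suc k)
    have "T \<le> 2 ^ k * T" using mult_right_mono[of 1 "2 ^ k" T] Tp by simp
    then have "h (2 ^ k * T) \<le> h (2 * (2 ^ k * T))" using T by blast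
    then show ?case using Suc by (simp add: mult.assoc)
  qed simp
  have "(h \<longlongrightarrow> \<bar>0\<bar>) at_top"
    unfolding h_def by (intro tendsto_rabs smalloD_tendsto step assms(2))
  then have "(\<lambda>k. h (2 ^ k * T)) \<longlonglongrightarrow> \<bar>0\<bar>"
    using filterlim_pow_mult_at_top[OF Tp(1)] by (rule filterlim_compose)
  then have "h T \<le> \<bar>0\<bar>" using low by (intro LIMSEQ_le_const) auto
  then show False using Tp(2) by simp
qed

text \<open>Each left eigenvector yields an almost homogeneous scalar function, hence one constant
  in front of t^b. The combination weighted by the two constants cancels t^b and is o(g_n), so its
  coefficients vanish; if both constants are zero, \<open>v\<close> itself vanishes.\<close>

lemma left_eigenvectors_dependent:
  assumes A: "\<And>x. x > 0 \<Longrightarrow> scales x (A x)" and last: "A 2 (n - 1) (n - 1) = 2 powr \<gamma>" and less: "\<gamma> < b"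
    and v: "\<And>x j. x > 0 \<Longrightarrow> j < n \<Longrightarrow> (\<Sum>i<n. v i * A x i j) = x powr b * v j"
    and w: "\<And>x j. x > 0 \<Longrightarrow> j < n \<Longrightarrow> (\<Sum>i<n. w i * A x i j) = x powr b * w j"
  shows "\<exists>p q. (p \<noteq> 0 \<or> q \<noteq> 0) \<and> (\<forall>i<n. p * v i + q * w i = 0)"
proof -
  have n1: "n - 1 < n" using n_pos by simp
  have zero: "\<forall>i<n. v i = 0" if "(\<lambda>t. \<Sum>i<n. v i * g i t) \<in> o[at_top](g (n - 1))" for v
    using coeff_zero[OF n1 that] by auto
  have ex: "\<exists>c. (\<lambda>t. (\<Sum>i<n. v i * g i t) - c * t powr b) \<in> o[at_top](g (n - 1))"
    if v: "\<And>x j. x > 0 \<Longrightarrow> j < n \<Longrightarrow> (\<Sum>i<n. v i * A x i j) = x powr b * v j" for v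
  proof -
    have hom: "(\<lambda>t. (\<Sum>i<n. v i * g i (x * t)) - x powr b * (\<Sum>i<n. v i * g i t)) \<in> o[at_top](g (n - 1))"
      if x: "x > 0" for x
    proof -
      have "(\<lambda>t. \<Sum>i<n. v i * (g i (x * t) - (\<Sum>j<n. A x i j * g j t))) \<in> o[at_top](g (n - 1))"
        using scalesD[OF A[OF x]] by (intro big_sum_in_smallo) simp
      also have "(\<lambda>t. \<Sum>i<n. v i * (g i (x * t) - (\<Sum>j<n. A x i j * g j t)))
          = (\<lambda>t. (\<Sum>i<n. v i * g i (x * t)) - x powr b * (\<Sum>i<n. v i * g i t))"
      proof
        fix t
        have "(\<Sum>i<n. v i * (\<Sum>j<n. A x i j * g j t)) = (\<Sum>i<n. \<Sum>j<n. v i * A x i j * g j t)"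
          by (simp add: sum_distrib_left mult.assoc)
        also have "\<dots> = (\<Sum>j<n. (\<Sum>i<n. v i * A x i j) * g j t)"
          unfolding sum_distrib_right by (rule sum.swap)
        also have "\<dots> = (\<Sum>j<n. x powr b * (v j * g j t))"
          using v[OF x] by (intro sum.cong) (auto simp: mult.assoc)
        finally show "(\<Sum>i<n. v i * (g i (x * t) - (\<Sum>j<n. A x i j * g j t)))
            = (\<Sum>i<n. v i * g i (x * t)) - x powr b * (\<Sum>i<n. v i * g i t)"
          by (simp add: right_diff_distrib sum_subtractf sum_distrib_left)
      qed
      finally show ?thesis .
    qed
    have "((\<lambda>t. g (n - 1) (2 * t) / g (n - 1) t) \<longlongrightarrow> 2 powr \<gamma>) at_top"
      using scales_diag_limit[OF A _ n1, of 2] last by simp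
    from almost_homogeneous_asymptotics[of "\<lambda>t. \<Sum>i<n. v i * g i t", OF hom this less ev_nonzero[OF n1]]
    show ?thesis by blast
  qed
  obtain cv cw where cv: "(\<lambda>t. (\<Sum>i<n. v i * g i t) - cv * t powr b) \<in> o[at_top](g (n - 1))"
    and cw: "(\<lambda>t. (\<Sum>i<n. w i * g i t) - cw * t powr b) \<in> o[at_top](g (n - 1))"
    using ex[OF v] ex[OF w] by blast
  show ?thesis
  proof (cases "cv = 0 \<and> cw = 0")
    case True
    then have "\<forall>i<n. v i = 0" using cv by (intro zero) simp
    then show ?thesis by (intro exI[of _ 1] exI[of _ 0]) simp
  next
    case False
    have "(\<lambda>t. cw * ((\<Sum>i<n. v i * g i t) - cv * t powr b) - cv * ((\<Sum>i<n. w i * g i t) - cw * t powr b))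
        \<in> o[at_top](g (n - 1))"
      using cv cw by (intro sum_in_smallo) simp_all
    also have "(\<lambda>t. cw * ((\<Sum>i<n. v i * g i t) - cv * t powr b) - cv * ((\<Sum>i<n. w i * g i t) - cw * t powr b))
        = (\<lambda>t. \<Sum>i<n. (cw * v i + (- cv) * w i) * g i t)"
      by (simp add: fun_eq_iff algebra_simps sum_subtractf sum_distrib_left)
    finally have "\<forall>i<n. cw * v i + (- cv) * w i = 0" by (rule zero)
    then show ?thesis using False by (intro exI[of _ cw] exI[of _ "- cv"]) auto
  qed
qed

end

section \<open>Existence of the index matrix\<close>

lemma scales_by_iff:
  assumes "rates n g" "A \<in> carrier_mat n n"
  shows "scales_by n g x A \<longleftrightarrow> rates.scales n g x (\<lambda>i j. A $$ (i, j))"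
proof -
  interpret rates n g by fact
  have "(eval_vec n g (x * t) - A *\<^sub>v eval_vec n g t) $ i = g i (x * t) - (\<Sum>j<n. A $$ (i, j) * g j t)"
    if "i < n" for i t
    using that assms(2) by (simp add: eval_vec_def scalar_prod_def atLeast0LessThan)
  then show ?thesis by (simp add: scales_by_def scales_def)
qed

lemma rates_if_rate_vector:
  assumes "rate_vector n D g"
  shows "rates n g"
proof
  fix i assume "i < n"
  then have "eventually_constant_sign (g i)" using assms by (simp add: rate_vector_def)
  then show "\<forall>\<^sub>F t in at_top. g i t \<noteq> 0"
    unfolding eventually_constant_sign_def by (auto elim: eventually_mono)
qed (use assms in \<open>auto simp: rate_vector_def\<close>)

text \<open>Extension by zero from a half-line: dilated arguments range over all reals, and limits
  at infinity do not see the change.\<close>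

lemma measurable_extension:
  assumes "nbhd_of_infinity D" "f \<in> borel_measurable (lebesgue_on D)"
  obtains G where "G \<in> borel_measurable lebesgue" "\<forall>\<^sub>F t in at_top. G t = (f t :: real)"
proof -
  obtain t0 where t0: "{t0..} \<subseteq> D" using assms(1) by (auto simp: nbhd_of_infinity_def)
  have "f \<in> borel_measurable (lebesgue_on {t0..})"
    using assms(2) t0 by (rule measurable_restrict_mono)
  then have "(\<lambda>t. if t \<in> {t0..} then f t else 0) \<in> borel_measurable lebesgue"
    by (intro borel_measurable_if_I) auto
  moreover have "\<forall>\<^sub>F t in at_top. (if t \<in> {t0..} then f t else 0) = f t"
    using eventually_ge_at_top[of t0] by eventually_elim simp
  ultimately show ?thesis by (rule that)
qed

lemma eigenvalue_upper_triangular: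
  fixes B :: "'a :: field mat"
  assumes "B \<in> carrier_mat n n" "upper_triangular B" "eigenvalue B c"
  obtains i where "i < n" "c = B $$ (i, i)"
proof -
  have "poly (\<Prod>a\<leftarrow>diag_mat B. [:- a, 1:]) c = 0"
    using assms eigenvalue_root_char_poly[OF assms(1)] char_poly_upper_triangular[OF assms(1,2)] by simp
  then have "c \<in> set (diag_mat B)"
    by (auto simp: poly_prod_list prod_list_zero_iff)
  then show ?thesis using that assms(1) by (auto simp: diag_mat_def)
qed

theorem theorem3p6:
  fixes n :: nat and D :: "nat \<Rightarrow> real set" and g :: "nat \<Rightarrow> real \<Rightarrow> real"
  assumes "rate_vector n D g"
    and "measurable_components n D g"
    and "\<exists>E. E \<subseteq> scaling_set n g \<and> E \<in> sets lebesgue \<and> emeasure lebesgue E > 0"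
    and "scaling_set n g \<inter> {0<..<1} \<noteq> {}"
    and "scaling_set n g \<inter> {1<..} \<noteq> {}"
  shows "\<exists>B. index_matrix n B \<and> regularly_varying n D g B"
proof -
  interpret rates n g using assms(1) by (rule rates_if_rate_vector)
  note scales_by_iff = scales_by_iff[OF rates_axioms]
  have S_iff: "x \<in> scaling_set n g \<longleftrightarrow> x > 0 \<and> (\<exists>A\<in>carrier_mat n n. scales x (\<lambda>i j. A $$ (i, j)))" for x
    by (auto simp: scaling_set_def scales_by_iff)
  obtain E where E: "E \<subseteq> scaling_set n g" "E \<in> sets lebesgue" "emeasure lebesgue E > 0"
    using assms(3) by blast
  have "scaling_set n g = {0<..}"
  proof (rule mult_semigroup_positive_reals[OF _ _ E assms(4,5)])
    fix x y assume "x \<in> scaling_set n g" "y \<in> scaling_set n g"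
    then obtain A C where AC: "x > 0" "A \<in> carrier_mat n n" "scales x (\<lambda>i j. A $$ (i, j))"
      "y > 0" "C \<in> carrier_mat n n" "scales y (\<lambda>i j. C $$ (i, j))"
      unfolding S_iff by blast
    have "scales (x * y) (\<lambda>i j. (A * C) $$ (i, j)) \<longleftrightarrow> scales (x * y) (\<lambda>i k. \<Sum>j<n. A $$ (i, j) * C $$ (j, k))"
      using mult_mat_index_sum[OF AC(2,5)] by (simp add: scales_def)
    with scales_mult[OF AC(3,1,6,4)] AC show "x * y \<in> scaling_set n g"
      unfolding S_iff by (intro conjI bexI[of _ "A * C"]) auto
  qed (auto simp: S_iff)
  then have "\<forall>x\<in>{0<..}. \<exists>A. A \<in> carrier_mat n n \<and> scales x (\<lambda>i j. A $$ (i, j))"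
    using S_iff by blast
  \<comment> \<open>The matrices are chosen pointwise in x; uniqueness modulo the last rate is what
    makes this arbitrary choice multiplicative.\<close>
  then obtain A where A: "\<And>x. x > 0 \<Longrightarrow> A x \<in> carrier_mat n n \<and> scales x (\<lambda>i j. A x $$ (i, j))"
    using bchoice[of "{0<..}" "\<lambda>x A. A \<in> carrier_mat n n \<and> scales x (\<lambda>i j. A $$ (i, j))"] by auto
  define a where "a x i j = A x $$ (i, j)" for x i j
  have a: "scales x (a x)" if "x > 0" for x using A[OF that] unfolding a_def[abs_def] by blast
  interpret triangular_hom n a
  proof
    fix x y :: real and i k assume "x > 0" "y > 0" "i < n" "k < n"
    then show "a (x * y) i k = (\<Sum>j<n. a x i j * a y j k)"
      using scales_unique[OF a scales_mult[OF a _ a]] by simp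
  next
    fix i j assume "i < n" "j < n"
    then show "a 1 i j = (if i = j then 1 else 0)"
      using scales_unique[OF a scales_one] by simp
  next
    fix x :: real and i j assume "x > 0" "i < n" "j < i"
    then show "a x i j = 0" using scales_triangular[OF a] by blast
  next
    fix i j assume ij: "i < n" "j < n"
    have "nbhd_of_infinity (D i)" "g i \<in> borel_measurable (lebesgue_on (D i))"
      using assms(1,2) ij(1) unfolding rate_vector_def measurable_components_def by blast+
    then obtain G where "G \<in> borel_measurable lebesgue" "\<forall>\<^sub>F t in at_top. G t = g i t"
      by (rule measurable_extension)
    then show "(\<lambda>x. a x i j) \<in> borel_measurable (lebesgue_on {0<..})"
      using scales_measurable[of a "\<lambda>_. G" i j] a ij by simp
  qed
  obtain B where B: "B \<in> carrier_mat n n" "upper_triangular B"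
    and sums: "\<And>x i j. \<lbrakk>x > 0; i < n; j < n\<rbrakk> \<Longrightarrow> (\<lambda>k. (B ^\<^sub>m k) $$ (i, j) / fact k * ln x ^ k) sums a x i j"
    using hom_exp_series by blast
  have diag: "a x i i = x powr (B $$ (i, i))" if "x > 0" "i < n" for x i
    using sums[OF that that(2)] exp_series_sums_powr[OF that(1), of "B $$ (i, i)"]
      upper_triangular_pow_index(2)[OF B that(2)] by (simp add: sums_unique2)
  \<comment> \<open>Summing the exponential series against \<open>v\<close> shows that a left
    eigenvector of \<open>B\<close> is one of every \<open>a x\<close>, with eigenvalue x^b.\<close>
  have left: "(\<Sum>i<n. v i * a x i j) = x powr b * v j"
    if v: "\<And>j. j < n \<Longrightarrow> (\<Sum>i<n. v i * B $$ (i, j)) = b * v j" and xj: "x > 0" "j < n" for v b x j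
  proof (rule sums_unique2)
    show "(\<lambda>k. \<Sum>i<n. v i * ((B ^\<^sub>m k) $$ (i, j) / fact k * ln x ^ k)) sums (\<Sum>i<n. v i * a x i j)"
      using sums xj by (intro sums_sum sums_mult) auto
    have "(\<Sum>i<n. v i * ((B ^\<^sub>m k) $$ (i, j) / fact k * ln x ^ k)) = b ^ k / fact k * ln x ^ k * v j" for k
    proof -
      have "(\<Sum>i<n. v i * ((B ^\<^sub>m k) $$ (i, j) / fact k * ln x ^ k))
          = (\<Sum>i<n. v i * (B ^\<^sub>m k) $$ (i, j)) / fact k * ln x ^ k"
        by (simp add: sum_distrib_right sum_divide_distrib mult.assoc)
      then show ?thesis using left_eigenvector_pow[OF B(1) v xj(2), of k] by simp
    qed
    then show "(\<lambda>k. \<Sum>i<n. v i * ((B ^\<^sub>m k) $$ (i, j) / fact k * ln x ^ k)) sums (x powr b * v j)"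
      using sums_mult2[OF exp_series_sums_powr[OF xj(1), of b], of "v j"] by simp
  qed
  have mono: "B $$ (j, j) \<le> B $$ (i, i)" if "i \<le> j" "j < n" for i j
    using that
  proof (induction j rule: dec_induct)
    case (step j)
    have "B $$ (Suc j, Suc j) \<le> B $$ (j, j)"
      using step.prems by (intro index_le_Suc[OF a]) (auto simp: diag)
    then show ?case using step by simp
  qed simp
  have "geometric_multiplicity B b = 1" if b: "eigenvalue B b" and c: "eigenvalue B c" "c < b" for b c
    unfolding geometric_multiplicity_def
  proof (rule kernel_dim_eq_one)
    show "char_matrix B b \<in> carrier_mat n n" using B by simp
    show "det (char_matrix B b) = 0" using eigenvalue_det[OF B(1)] b by simp
    \<comment> \<open>A smaller eigenvalue \<open>c\<close> is a diagonal entry, so by monotonicity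
      the last diagonal entry, which is the index of the last rate, is also strictly below
      \<open>b\<close>.\<close>
    obtain i where "i < n" "c = B $$ (i, i)" by (rule eigenvalue_upper_triangular[OF B c(1)])
    then have less: "B $$ (n - 1, n - 1) < b" using mono[of i "n - 1"] c(2) by linarith
    have eig: "(\<Sum>i<n. v i * B $$ (i, j)) = b * v j"
      if "\<And>j. j < n \<Longrightarrow> (\<Sum>i<n. v i * char_matrix B b $$ (i, j)) = 0" "j < n" for v :: "nat \<Rightarrow> real" and j
    proof -
      have "(\<Sum>i<n. v i * char_matrix B b $$ (i, j)) = (\<Sum>i<n. v i * B $$ (i, j) - (if i = j then b * v i else 0))"
        using B that(2) by (intro sum.cong) (auto simp: char_matrix_def algebra_simps)
      then show ?thesis using that by (simp add: sum_subtractf)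
    qed
    fix v w :: "nat \<Rightarrow> real"
    assume v: "\<And>j. j < n \<Longrightarrow> (\<Sum>i<n. v i * char_matrix B b $$ (i, j)) = 0"
      and w: "\<And>j. j < n \<Longrightarrow> (\<Sum>i<n. w i * char_matrix B b $$ (i, j)) = 0"
    show "\<exists>p q. (p \<noteq> 0 \<or> q \<noteq> 0) \<and> (\<forall>i<n. p * v i + q * w i = 0)"
    proof (rule left_eigenvectors_dependent[OF a _ less])
      show "a 2 (n - 1) (n - 1) = 2 powr B $$ (n - 1, n - 1)" using diag[of 2 "n - 1"] n_pos by simp
    qed (use left[OF eig] v w in auto)
  qed
  then have index: "index_matrix n B"
    using B mono unfolding index_matrix_def by blast
  have "scales_by n g x (mat_powr x B)" if x: "x > 0" for x
  proof -
    have "mat_powr x B \<in> carrier_mat n n" using B by (simp add: mat_powr_def mat_exp_def)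
    moreover have "mat_powr x B $$ (i, j) = a x i j" if "i < n" "j < n" for i j
      using mat_powr_index_sums[OF B(1) that sums[OF x that]] .
    then have "scales x (\<lambda>i j. mat_powr x B $$ (i, j))"
      using a[OF x] by (simp add: scales_def)
    ultimately show ?thesis by (simp add: scales_by_iff)
  qed
  then have "regularly_varying n D g B"
    using assms(1,2) index by (simp add: regularly_varying_def)
  with index show ?thesis by blast
qed

end
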